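(* Let $S$ be a split-by-nilpotent extension of a ring $R$, i.e. there are identity-preserving ring homomorphisms $R\xrightarrow{\iota}S\xrightarrow{\pi}R$ with $\pi\iota=\mathrm{id}_R$ and with $J:=\ker\pi$ a nilpotent ideal. If $X$ is a left $S$-module such that $\operatorname{Tor}_i^S(R,X)=0$ for all $i>0$, then $$\operatorname{pd}_S X=\operatorname{pd}_R(R\otimes_S X),$$ where the equality holds in $\mathbb N\cup\{0,\infty\}$.
   Context: Rings are associative with identity, not necessarily commutative, and modules are unital left modules. $\operatorname{pd}_A X$ denotes the projective dimension of the left $A$-module $X$, with values in $\mathbb N\cup\{0,\infty\}$. $J$ nilpotent means $J^t=0$ for some $t\ge 1$. In tensor products and Tor groups over $S$, $R$ is viewed as a right $S$-module through $\pi$ (so $R\cong S/J$); $R\otimes_S X\cong X/JX$ is a left $R$-module. *)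

theory Defs
  imports "HOL-Algebra.Free_Abelian_Groups" "HOL-Algebra.Ideal_Product" "HOL-Algebra.Module"
    "HOL-Library.Extended_Nat"
begin

text \<open>
  \<open>HOL-Algebra.Module\<close> only has modules over commutative rings. The following locale has the
  same axioms over an arbitrary ring; the record type of modules is reused (its multiplicative
  fields play no role).
\<close>

locale left_module = R?: ring R + M?: abelian_group M
  for R :: "('r, 'k) ring_scheme" (structure) and M :: "('r, 'a) module" (structure) +
  assumes smult_closed:
      "\<lbrakk>a \<in> carrier R; x \<in> carrier M\<rbrakk> \<Longrightarrow> a \<odot>\<^bsub>M\<^esub> x \<in> carrier M"
    and smult_l_distr:
      "\<lbrakk>a \<in> carrier R; b \<in> carrier R; x \<in> carrier M\<rbrakk> \<Longrightarrow>
        (a \<oplus>\<^bsub>R\<^esub> b) \<odot>\<^bsub>M\<^esub> x = a \<odot>\<^bsub>M\<^esub> x \<oplus>\<^bsub>M\<^esub> b \<odot>\<^bsub>M\<^esub> x"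
    and smult_r_distr:
      "\<lbrakk>a \<in> carrier R; x \<in> carrier M; y \<in> carrier M\<rbrakk> \<Longrightarrow>
        a \<odot>\<^bsub>M\<^esub> (x \<oplus>\<^bsub>M\<^esub> y) = a \<odot>\<^bsub>M\<^esub> x \<oplus>\<^bsub>M\<^esub> a \<odot>\<^bsub>M\<^esub> y"
    and smult_assoc:
      "\<lbrakk>a \<in> carrier R; b \<in> carrier R; x \<in> carrier M\<rbrakk> \<Longrightarrow>
        (a \<otimes>\<^bsub>R\<^esub> b) \<odot>\<^bsub>M\<^esub> x = a \<odot>\<^bsub>M\<^esub> (b \<odot>\<^bsub>M\<^esub> x)"
    and smult_one:
      "x \<in> carrier M \<Longrightarrow> \<one>\<^bsub>R\<^esub> \<odot>\<^bsub>M\<^esub> x = x"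

definition left_module_hom ::
    "('r, 'k) ring_scheme \<Rightarrow> ('r, 'a) module \<Rightarrow> ('r, 'b) module \<Rightarrow> ('a \<Rightarrow> 'b) set"
  where "left_module_hom R M N =
    {h. h \<in> carrier M \<rightarrow> carrier N \<and>
        (\<forall>x\<in>carrier M. \<forall>y\<in>carrier M. h (x \<oplus>\<^bsub>M\<^esub> y) = h x \<oplus>\<^bsub>N\<^esub> h y) \<and>
        (\<forall>a\<in>carrier R. \<forall>x\<in>carrier M. h (a \<odot>\<^bsub>M\<^esub> x) = a \<odot>\<^bsub>N\<^esub> h x)}"

text \<open>
  HOL cannot quantify over modules of all types inside a definition, so modules that are quantified
  over are taken with carriers inside the following type, determined by the type \<open>'r\<close> of scalars and
  the type \<open>'a\<close> of elements of a given module \<open>M\<close>. This type is infinite, receives injections from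
  \<open>'r\<close> and \<open>'a\<close>, and has the same cardinality as the type of finite lists over itself.
  Hence it contains copies of \<open>M\<close>, of the free module on (the underlying set of) \<open>M\<close>, and of the free
  module on (the underlying set of) any module already inside it, so nothing is lost:
  \<^item> the lifting property below, tested only against modules in this type, already provides a
    section of the free cover of \<open>P\<close>, hence gives the lifting property against modules of every type;
  \<^item> \<open>M\<close> has a projective resolution inside this type; if it has one of length at most \<open>n\<close> at all,
    then the \<open>n\<close>-th syzygy of any projective resolution is projective (Schanuel), so truncating
    one inside this type gives a resolution of length at most \<open>n\<close> inside this type.
\<close>

type_synonym ('r, 'a) univ = "('r + 'a + nat) list"

definition projective_module :: "('r, 'k) ring_scheme \<Rightarrow> ('r, 'a) module \<Rightarrow> bool"
  where "projective_module R P \<longleftrightarrow> left_module R P \<and>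
    (\<forall>(M :: ('r, ('r, 'a) univ) module) (N :: ('r, ('r, 'a) univ) module) g f.
       left_module R M \<and> left_module R N \<and>
       g \<in> left_module_hom R M N \<and> g ` carrier M = carrier N \<and> f \<in> left_module_hom R P N \<longrightarrow>
       (\<exists>h\<in>left_module_hom R P M. \<forall>x\<in>carrier P. g (h x) = f x))"

text \<open>
  The exact sequence \<open>\<dots> \<rightarrow> P 2 \<rightarrow> P 1 \<rightarrow> P 0 \<rightarrow> X \<rightarrow> 0\<close> with differentials
  \<open>d i : P (i + 1) \<rightarrow> P i\<close> and augmentation \<open>e\<close>.
\<close>

definition projective_resolution ::
    "('r, 'k) ring_scheme \<Rightarrow> (nat \<Rightarrow> ('r, 'p) module) \<Rightarrow> (nat \<Rightarrow> 'p \<Rightarrow> 'p) \<Rightarrow> ('p \<Rightarrow> 'a) \<Rightarrow>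
      ('r, 'a) module \<Rightarrow> bool"
  where "projective_resolution R P d e X \<longleftrightarrow>
    (\<forall>i. projective_module R (P i)) \<and>
    (\<forall>i. d i \<in> left_module_hom R (P (Suc i)) (P i)) \<and>
    e \<in> left_module_hom R (P 0) X \<and>
    e ` carrier (P 0) = carrier X \<and>
    a_kernel (P 0) X e = d 0 ` carrier (P 1) \<and>
    (\<forall>i. a_kernel (P (Suc i)) (P i) (d i) = d (Suc i) ` carrier (P (Suc (Suc i))))"

text \<open>The infimum of the empty set is \<open>\<infinity>\<close>; the zero module has dimension \<open>0\<close>.\<close>

definition proj_dim :: "('r, 'k) ring_scheme \<Rightarrow> ('r, 'a) module \<Rightarrow> enat"
  where "proj_dim R X =
    Inf {enat n | n. \<exists>(P :: nat \<Rightarrow> ('r, ('r, 'a) univ) module) d e.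
           projective_resolution R P d e X \<and> (\<forall>i>n. carrier (P i) = {\<zero>\<^bsub>P i\<^esub>})}"

text \<open>
  Tensor products \<open>N \<otimes>\<^sub>S X\<close> of a right and a left \<open>S\<close>-module. A right module \<open>N\<close> is given as a
  module record whose \<^const>\<open>smult\<close> is the right action with arguments swapped:
  \<open>s \<odot>\<^bsub>N\<^esub> n\<close> stands for \<open>n s\<close>.
\<close>

definition tensor_rel ::
    "('s, 'k) ring_scheme \<Rightarrow> ('s, 'n) module \<Rightarrow> ('s, 'a) module \<Rightarrow> ('n \<times> 'a \<Rightarrow>\<^sub>0 int) set"
  where "tensor_rel S N X = generate (free_Abelian_group (carrier N \<times> carrier X))
    ({frag_of (n \<oplus>\<^bsub>N\<^esub> n', x) - frag_of (n, x) - frag_of (n', x) | n n' x.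
        n \<in> carrier N \<and> n' \<in> carrier N \<and> x \<in> carrier X} \<union>
     {frag_of (n, x \<oplus>\<^bsub>X\<^esub> x') - frag_of (n, x) - frag_of (n, x') | n x x'.
        n \<in> carrier N \<and> x \<in> carrier X \<and> x' \<in> carrier X} \<union>
     {frag_of (s \<odot>\<^bsub>N\<^esub> n, x) - frag_of (n, s \<odot>\<^bsub>X\<^esub> x) | s n x.
        s \<in> carrier S \<and> n \<in> carrier N \<and> x \<in> carrier X})"

definition tensor_group ::
    "('s, 'k) ring_scheme \<Rightarrow> ('s, 'n) module \<Rightarrow> ('s, 'a) module \<Rightarrow> ('n \<times> 'a \<Rightarrow>\<^sub>0 int) set monoid"
  where "tensor_group S N X = free_Abelian_group (carrier N \<times> carrier X) Mod tensor_rel S N X"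

text \<open>
  The map \<open>N \<otimes> X \<rightarrow> N \<otimes> Y\<close> with \<open>n \<otimes> x \<mapsto> u n \<otimes> f x\<close>, for additive maps \<open>u\<close> and \<open>f\<close> that are compatible
  with the actions of \<open>S\<close>. It is defined via representatives of cosets.
\<close>

definition tensor_map ::
    "('s, 'k) ring_scheme \<Rightarrow> ('s, 'n) module \<Rightarrow> ('s, 'b) module \<Rightarrow> ('n \<Rightarrow> 'n) \<Rightarrow> ('a \<Rightarrow> 'b) \<Rightarrow>
      ('n \<times> 'a \<Rightarrow>\<^sub>0 int) set \<Rightarrow> ('n \<times> 'b \<Rightarrow>\<^sub>0 int) set"
  where "tensor_map S N Y u f C =
    the_elem ((\<lambda>c. tensor_rel S N Y #>\<^bsub>free_Abelian_group (carrier N \<times> carrier Y)\<^esub>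
                     frag_extend (\<lambda>(n, x). frag_of (u n, f x)) c) ` C)"

text \<open>
  \<open>N \<otimes>\<^sub>S X\<close> as a left module when \<open>N\<close> is a bimodule whose left action is \<open>l\<close>.
\<close>

definition tensor_module ::
    "('r \<Rightarrow> 'n \<Rightarrow> 'n) \<Rightarrow> ('s, 'k) ring_scheme \<Rightarrow> ('s, 'n) module \<Rightarrow> ('s, 'a) module \<Rightarrow>
      ('r, ('n \<times> 'a \<Rightarrow>\<^sub>0 int) set) module"
  where "tensor_module l S N X =
    \<lparr>carrier = carrier (tensor_group S N X), mult = undefined, one = undefined,
     zero = \<one>\<^bsub>tensor_group S N X\<^esub>, add = mult (tensor_group S N X),
     smult = (\<lambda>r. tensor_map S N X (l r) (\<lambda>x. x))\<rparr>"

text \<open>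
  \<open>Tor\<^sub>i\<^sup>S(N, X)\<close> is the \<open>i\<close>-th homology group of \<open>N \<otimes>\<^sub>S P\<close> for a chosen projective resolution \<open>P\<close> of \<open>X\<close>.
\<close>

definition chosen_resolution ::
    "('s, 'k) ring_scheme \<Rightarrow> ('s, 'a) module \<Rightarrow>
      (nat \<Rightarrow> ('s, ('s, 'a) univ) module) \<times> (nat \<Rightarrow> ('s, 'a) univ \<Rightarrow> ('s, 'a) univ) \<times>
      (('s, 'a) univ \<Rightarrow> 'a)"
  where "chosen_resolution S X = (SOME (P, d, e). projective_resolution S P d e X)"

definition Tor ::
    "('s, 'k) ring_scheme \<Rightarrow> ('s, 'n) module \<Rightarrow> ('s, 'a) module \<Rightarrow> nat \<Rightarrow>
      ('n \<times> ('s, 'a) univ \<Rightarrow>\<^sub>0 int) set set monoid"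
  where "Tor S N X i =
    (let (P, d, e) = chosen_resolution S X;
         T = (\<lambda>j. tensor_group S N (P j));
         \<delta> = (\<lambda>j. tensor_map S N (P j) (\<lambda>n. n) (d j));
         Z = (case i of 0 \<Rightarrow> carrier (T 0) | Suc j \<Rightarrow> kernel (T (Suc j)) (T j) (\<delta> j))
     in (T i)\<lparr>carrier := Z\<rparr> Mod (\<delta> i ` carrier (T (Suc i))))"

definition split_by_nilpotent_extension ::
    "('s, 'k) ring_scheme \<Rightarrow> ('r, 'l) ring_scheme \<Rightarrow> ('r \<Rightarrow> 's) \<Rightarrow> ('s \<Rightarrow> 'r) \<Rightarrow> bool"
  where "split_by_nilpotent_extension S R \<iota> \<pi> \<longleftrightarrow>
    ring S \<and> ring R \<and> \<iota> \<in> ring_hom R S \<and> \<pi> \<in> ring_hom S R \<and>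
    (\<forall>r\<in>carrier R. \<pi> (\<iota> r) = r) \<and>
    (\<exists>t\<ge>1. a_kernel S R \<pi> [^]\<^bsub>ideals_set S\<^esub> (t::nat) = {\<zero>\<^bsub>S\<^esub>})"

definition right_module_via ::
    "('r, 'l) ring_scheme \<Rightarrow> ('s \<Rightarrow> 'r) \<Rightarrow> ('s, 'r) module"
  where "right_module_via R \<pi> =
    \<lparr>carrier = carrier R, mult = mult R, one = one R, zero = zero R, add = add R,
     smult = (\<lambda>s r. r \<otimes>\<^bsub>R\<^esub> \<pi> s)\<rparr>"

text \<open>\<open>R \<otimes>\<^sub>S X\<close>, where \<open>R\<close> acts by left multiplication on the first factor.\<close>

definition base_change ::
    "('s, 'k) ring_scheme \<Rightarrow> ('r, 'l) ring_scheme \<Rightarrow> ('s \<Rightarrow> 'r) \<Rightarrow> ('s, 'a) module \<Rightarrow>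
      ('r, ('r \<times> 'a \<Rightarrow>\<^sub>0 int) set) module"
  where "base_change S R \<pi> X = tensor_module (mult R) S (right_module_via R \<pi>) X"

end

theory Submission
  imports Defs
begin

text \<open>
  Let \<open>P\<close> be a projective resolution of \<open>X\<close>. A comparison of resolutions shows that \<open>pd X \<le> n\<close> holds
  if and only if the image of \<open>d n\<close> is a direct summand of \<open>P n\<close>. As \<open>Tor\<close> vanishes, \<open>R \<otimes> P\<close> is a
  projective resolution of \<open>R \<otimes> X\<close>, so it suffices to compare the two summand conditions. A splitting
  over \<open>S\<close> induces one over \<open>R\<close>. Conversely, a projection over \<open>R\<close> with kernel the image \<open>R \<otimes> B\<close> of
  \<open>B = d n (P (n + 1))\<close> lifts to an endomorphism \<open>\<tau>\<close> of \<open>P n\<close> with \<open>x - \<tau> x \<in> B\<close> for all \<open>x\<close>; exactness of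
  \<open>R \<otimes> P\<close> yields \<open>\<tau> B \<subseteq> J B\<close>. Hence a power of \<open>\<tau>\<close> vanishes on \<open>B\<close>, and it is a projection with
  kernel \<open>B\<close>.
\<close>

section \<open>Modules over a noncommutative ring\<close>

text \<open>The delicate point is the inclusion \<tau> B \<subseteq> J B. An arbitrary lift of the
  projection over R would only satisfy \<tau> B \<subseteq> B \<inter> J (P n), which is too weak to
  iterate. Therefore the complementary map is lifted through P (n + 1), so that \<tau> = 1 - d n h
  with h : P n \<rightarrow> P (n + 1). For b = d n q this gives \<tau> b = d n (q - h b), and the
  class of q - h b in R \<otimes> P (n + 1) is a cycle. Vanishing of Tor in degree n + 1 turns this
  cycle into a boundary, so q - h b is a boundary up to an element of J (P (n + 1)), and d n removes
  the boundary.

  A second obstacle is typing. The modules R \<otimes> P i consist of cosets, whereas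
  \<open>proj_dim\<close> only sees resolutions whose elements have the type \<open>univ\<close>.
  The splitting criterion is therefore proved for a resolution over an arbitrary type of elements,
  and transferred between types by comparing resolutions.\<close>

lemma (in abelian_group) minus_self: "x \<in> carrier G \<Longrightarrow> x \<ominus> x = \<zero>"
  by (simp add: a_minus_def r_neg)

lemma (in abelian_group) uminus_zero: "\<ominus> \<zero> = \<zero>"
  by (rule minus_equality) simp_all

lemma (in abelian_group) minus_zero_right: "x \<in> carrier G \<Longrightarrow> x \<ominus> \<zero> = x"
  by (simp add: a_minus_def uminus_zero)

lemma (in abelian_group) minus_eq_zeroD:
  assumes "x \<ominus> y = \<zero>" "x \<in> carrier G" "y \<in> carrier G"
  shows "x = y"
proof -
  have "x = (x \<ominus> y) \<oplus> y"
    using assms(2,3) by (simp add: a_minus_def a_assoc l_neg)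
  then show ?thesis using assms by simp
qed

text \<open>The premise \<open>l_null\<close> stands in for the existence of additive inverses: (-1)
  x + x = 0 x = 0.\<close>

lemma left_moduleI:
  fixes R (structure) and M (structure)
  assumes "ring R"
    and zero: "\<zero>\<^bsub>M\<^esub> \<in> carrier M"
    and closed: "\<And>x y. \<lbrakk>x \<in> carrier M; y \<in> carrier M\<rbrakk> \<Longrightarrow> x \<oplus>\<^bsub>M\<^esub> y \<in> carrier M"
    and assoc: "\<And>x y z. \<lbrakk>x \<in> carrier M; y \<in> carrier M; z \<in> carrier M\<rbrakk> \<Longrightarrow>
      (x \<oplus>\<^bsub>M\<^esub> y) \<oplus>\<^bsub>M\<^esub> z = x \<oplus>\<^bsub>M\<^esub> (y \<oplus>\<^bsub>M\<^esub> z)"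
    and comm: "\<And>x y. \<lbrakk>x \<in> carrier M; y \<in> carrier M\<rbrakk> \<Longrightarrow> x \<oplus>\<^bsub>M\<^esub> y = y \<oplus>\<^bsub>M\<^esub> x"
    and l_zero: "\<And>x. x \<in> carrier M \<Longrightarrow> \<zero>\<^bsub>M\<^esub> \<oplus>\<^bsub>M\<^esub> x = x"
    and smult: "\<And>a x. \<lbrakk>a \<in> carrier R; x \<in> carrier M\<rbrakk> \<Longrightarrow> a \<odot>\<^bsub>M\<^esub> x \<in> carrier M"
    and l_null: "\<And>x. x \<in> carrier M \<Longrightarrow> \<zero> \<odot>\<^bsub>M\<^esub> x = \<zero>\<^bsub>M\<^esub>"
    and l_distr: "\<And>a b x. \<lbrakk>a \<in> carrier R; b \<in> carrier R; x \<in> carrier M\<rbrakk> \<Longrightarrow>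
        (a \<oplus> b) \<odot>\<^bsub>M\<^esub> x = a \<odot>\<^bsub>M\<^esub> x \<oplus>\<^bsub>M\<^esub> b \<odot>\<^bsub>M\<^esub> x"
    and r_distr: "\<And>a x y. \<lbrakk>a \<in> carrier R; x \<in> carrier M; y \<in> carrier M\<rbrakk> \<Longrightarrow>
        a \<odot>\<^bsub>M\<^esub> (x \<oplus>\<^bsub>M\<^esub> y) = a \<odot>\<^bsub>M\<^esub> x \<oplus>\<^bsub>M\<^esub> a \<odot>\<^bsub>M\<^esub> y"
    and m_assoc: "\<And>a b x. \<lbrakk>a \<in> carrier R; b \<in> carrier R; x \<in> carrier M\<rbrakk> \<Longrightarrow>
        (a \<otimes> b) \<odot>\<^bsub>M\<^esub> x = a \<odot>\<^bsub>M\<^esub> (b \<odot>\<^bsub>M\<^esub> x)"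
    and m_one: "\<And>x. x \<in> carrier M \<Longrightarrow> \<one> \<odot>\<^bsub>M\<^esub> x = x"
  shows "left_module R M"
proof -
  interpret R: ring R by fact
  have "\<exists>y\<in>carrier M. y \<oplus>\<^bsub>M\<^esub> x = \<zero>\<^bsub>M\<^esub>" if x: "x \<in> carrier M" for x
  proof
    show "(\<ominus> \<one>) \<odot>\<^bsub>M\<^esub> x \<oplus>\<^bsub>M\<^esub> x = \<zero>\<^bsub>M\<^esub>"
      using l_distr[of "\<ominus> \<one>" \<one> x] x by (simp add: l_null m_one R.l_neg)
  qed (use x smult in auto)
  then have "abelian_group M"
    by (intro abelian_groupI zero closed assoc comm l_zero) auto
  then show ?thesis
    by (intro left_module.intro left_module_axioms.intro \<open>ring R\<close> smult l_distr r_distr m_assoc m_one)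
qed

context left_module
begin

lemma smult_l_null: "x \<in> carrier M \<Longrightarrow> \<zero> \<odot>\<^bsub>M\<^esub> x = \<zero>\<^bsub>M\<^esub>"
  using smult_l_distr[of \<zero> \<zero> x] smult_closed[of \<zero> x] M.add.r_cancel_one' by auto

lemma smult_r_null: "a \<in> carrier R \<Longrightarrow> a \<odot>\<^bsub>M\<^esub> \<zero>\<^bsub>M\<^esub> = \<zero>\<^bsub>M\<^esub>"
  using smult_r_distr[of a "\<zero>\<^bsub>M\<^esub>" "\<zero>\<^bsub>M\<^esub>"] smult_closed[of a "\<zero>\<^bsub>M\<^esub>"] M.add.r_cancel_one' by auto

lemma smult_r_minus:
  assumes "a \<in> carrier R" "x \<in> carrier M"
  shows "a \<odot>\<^bsub>M\<^esub> (\<ominus>\<^bsub>M\<^esub> x) = \<ominus>\<^bsub>M\<^esub> (a \<odot>\<^bsub>M\<^esub> x)"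
proof -
  have "a \<odot>\<^bsub>M\<^esub> (\<ominus>\<^bsub>M\<^esub> x) \<oplus>\<^bsub>M\<^esub> a \<odot>\<^bsub>M\<^esub> x = \<zero>\<^bsub>M\<^esub>"
    using assms by (simp flip: smult_r_distr add: M.l_neg smult_r_null)
  then show ?thesis
    using assms M.minus_equality smult_closed by simp
qed

lemma smult_minus_one:
  assumes "x \<in> carrier M"
  shows "(\<ominus> \<one>) \<odot>\<^bsub>M\<^esub> x = \<ominus>\<^bsub>M\<^esub> x"
proof -
  have "(\<ominus> \<one>) \<odot>\<^bsub>M\<^esub> x \<oplus>\<^bsub>M\<^esub> x = \<zero>\<^bsub>M\<^esub>"
    using assms smult_l_distr[of "\<ominus> \<one>" \<one> x] by (simp add: R.l_neg smult_one smult_l_null)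
  then show ?thesis
    using assms M.minus_equality smult_closed by simp
qed

lemma smult_finsum:
  assumes "a \<in> carrier R" "finite B" "f \<in> B \<rightarrow> carrier M"
  shows "a \<odot>\<^bsub>M\<^esub> finsum M f B = finsum M (\<lambda>x. a \<odot>\<^bsub>M\<^esub> f x) B"
  using assms(2,3)
proof (induction B rule: finite_induct)
  case empty
  then show ?case using assms(1) by (simp add: smult_r_null)
next
  case (insert b B)
  then show ?case
    using assms(1) by (simp add: smult_r_distr Pi_iff smult_closed)
qed

end

subsection \<open>Homomorphisms\<close>

lemma left_module_homI:
  assumes "\<And>x. x \<in> carrier M \<Longrightarrow> h x \<in> carrier N"
    and "\<And>x y. \<lbrakk>x \<in> carrier M; y \<in> carrier M\<rbrakk> \<Longrightarrow> h (x \<oplus>\<^bsub>M\<^esub> y) = h x \<oplus>\<^bsub>N\<^esub> h y"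
    and "\<And>a x. \<lbrakk>a \<in> carrier R; x \<in> carrier M\<rbrakk> \<Longrightarrow> h (a \<odot>\<^bsub>M\<^esub> x) = a \<odot>\<^bsub>N\<^esub> h x"
  shows "h \<in> left_module_hom R M N"
  using assms by (auto simp: left_module_hom_def)

lemma left_module_hom_closed:
  "\<lbrakk>h \<in> left_module_hom R M N; x \<in> carrier M\<rbrakk> \<Longrightarrow> h x \<in> carrier N"
  by (auto simp: left_module_hom_def)

lemma left_module_hom_add:
  "\<lbrakk>h \<in> left_module_hom R M N; x \<in> carrier M; y \<in> carrier M\<rbrakk> \<Longrightarrow> h (x \<oplus>\<^bsub>M\<^esub> y) = h x \<oplus>\<^bsub>N\<^esub> h y"
  by (auto simp: left_module_hom_def)

lemma left_module_hom_smult: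
  "\<lbrakk>h \<in> left_module_hom R M N; a \<in> carrier R; x \<in> carrier M\<rbrakk> \<Longrightarrow> h (a \<odot>\<^bsub>M\<^esub> x) = a \<odot>\<^bsub>N\<^esub> h x"
  by (auto simp: left_module_hom_def)

lemma left_module_hom_zero:
  assumes "h \<in> left_module_hom R M N" "left_module R M" "left_module R N"
  shows "h \<zero>\<^bsub>M\<^esub> = \<zero>\<^bsub>N\<^esub>"
proof -
  interpret M: left_module R M by fact
  interpret N: left_module R N by fact
  show ?thesis
    using left_module_hom_smult[OF assms(1), of "\<zero>\<^bsub>R\<^esub>" "\<zero>\<^bsub>M\<^esub>"]
      left_module_hom_closed[OF assms(1), of "\<zero>\<^bsub>M\<^esub>"]
    by (simp add: M.smult_l_null N.smult_l_null)
qed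

lemma left_module_hom_uminus:
  assumes h: "h \<in> left_module_hom R M N" and "left_module R M" "left_module R N" and x: "x \<in> carrier M"
  shows "h (\<ominus>\<^bsub>M\<^esub> x) = \<ominus>\<^bsub>N\<^esub> h x"
proof -
  interpret M: left_module R M by fact
  interpret N: left_module R N by fact
  show ?thesis
    using left_module_hom_smult[OF h, of "\<ominus>\<^bsub>R\<^esub> \<one>\<^bsub>R\<^esub>" x] left_module_hom_closed[OF h x] x
    by (simp add: M.smult_minus_one N.smult_minus_one)
qed

lemma left_module_hom_diff:
  assumes h: "h \<in> left_module_hom R M N" and M: "left_module R M" and N: "left_module R N"
    and x: "x \<in> carrier M" and y: "y \<in> carrier M"
  shows "h (x \<ominus>\<^bsub>M\<^esub> y) = h x \<ominus>\<^bsub>N\<^esub> h y"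
proof -
  interpret M: left_module R M by fact
  show ?thesis
    using x y by (simp add: a_minus_def left_module_hom_add[OF h] left_module_hom_uminus[OF h M N])
qed

lemma left_module_hom_compose:
  assumes "f \<in> left_module_hom R L M" "g \<in> left_module_hom R M N"
  shows "(\<lambda>x. g (f x)) \<in> left_module_hom R L N"
  using assms by (auto simp: left_module_hom_def Pi_iff)

lemma left_module_hom_id: "(\<lambda>x. x) \<in> left_module_hom R M M"
  by (auto simp: left_module_hom_def)

lemma left_module_hom_plus:
  assumes f: "f \<in> left_module_hom R M N" and g: "g \<in> left_module_hom R M N" and "left_module R N"
  shows "(\<lambda>x. f x \<oplus>\<^bsub>N\<^esub> g x) \<in> left_module_hom R M N"
proof -
  interpret N: left_module R N by fact
  show ?thesis
    by (rule left_module_homI)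
      (simp_all add: left_module_hom_closed[OF f] left_module_hom_closed[OF g]
        left_module_hom_add[OF f] left_module_hom_add[OF g] N.a_ac
        left_module_hom_smult[OF f] left_module_hom_smult[OF g] N.smult_r_distr)
qed

lemma left_module_hom_minus:
  assumes f: "f \<in> left_module_hom R M N" and g: "g \<in> left_module_hom R M N" and "left_module R N"
  shows "(\<lambda>x. f x \<ominus>\<^bsub>N\<^esub> g x) \<in> left_module_hom R M N"
proof -
  interpret N: left_module R N by fact
  show ?thesis
    by (rule left_module_homI)
      (simp_all add: a_minus_def left_module_hom_closed[OF f] left_module_hom_closed[OF g]
        left_module_hom_add[OF f] left_module_hom_add[OF g] N.a_ac N.minus_add
        left_module_hom_smult[OF f] left_module_hom_smult[OF g] N.smult_r_distr N.smult_r_minus)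
qed

subsection \<open>Submodules\<close>

text \<open>Closure under negatives is contained in closure under the action of -1.\<close>

definition left_submodule :: "('r, 'k) ring_scheme \<Rightarrow> 'a set \<Rightarrow> ('r, 'a) module \<Rightarrow> bool"
  where "left_submodule R K M \<longleftrightarrow> K \<subseteq> carrier M \<and> \<zero>\<^bsub>M\<^esub> \<in> K \<and>
    (\<forall>x\<in>K. \<forall>y\<in>K. x \<oplus>\<^bsub>M\<^esub> y \<in> K) \<and> (\<forall>a\<in>carrier R. \<forall>x\<in>K. a \<odot>\<^bsub>M\<^esub> x \<in> K)"

lemma left_module_submodule:
  assumes "left_module R M" and K: "left_submodule R K M"
  shows "left_module R (M\<lparr>carrier := K\<rparr>)"
proof -
  interpret M: left_module R M by fact
  have [simp]: "x \<in> carrier M" if "x \<in> K" for x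
    using K that by (auto simp: left_submodule_def)
  show ?thesis
    by (rule left_moduleI)
      (use K in \<open>auto simp: left_submodule_def M.a_ac M.smult_l_null M.smult_l_distr M.smult_r_distr
        M.smult_assoc M.smult_one M.R.ring_axioms\<close>)
qed

lemma left_submodule_carrier:
  assumes "left_module R M"
  shows "left_submodule R (carrier M) M"
proof -
  interpret M: left_module R M by fact
  show ?thesis
    by (auto simp: left_submodule_def M.smult_closed)
qed

lemma left_submodule_image:
  assumes h: "h \<in> left_module_hom R M N" and "left_module R M" "left_module R N"
  shows "left_submodule R (h ` carrier M) N"
proof -
  interpret M: left_module R M by fact
  interpret N: left_module R N by fact
  have "\<zero>\<^bsub>N\<^esub> \<in> h ` carrier M"
    using left_module_hom_zero[OF assms] M.zero_closed by (metis imageI)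
  moreover have "h x \<oplus>\<^bsub>N\<^esub> h y \<in> h ` carrier M" if "x \<in> carrier M" "y \<in> carrier M" for x y
    using left_module_hom_add[OF h that] that by (metis imageI M.a_closed)
  moreover have "a \<odot>\<^bsub>N\<^esub> h x \<in> h ` carrier M" if "a \<in> carrier R" "x \<in> carrier M" for a x
    using left_module_hom_smult[OF h that] that by (metis imageI M.smult_closed)
  ultimately show ?thesis
    using left_module_hom_closed[OF h] by (auto simp: left_submodule_def)
qed

lemma left_submodule_kernel:
  assumes h: "h \<in> left_module_hom R M N" and "left_module R M" "left_module R N"
  shows "left_submodule R (a_kernel M N h) M"
proof -
  interpret M: left_module R M by fact
  interpret N: left_module R N by fact
  show ?thesis
    using left_module_hom_zero[OF assms]
    by (auto simp: left_submodule_def a_kernel_def' left_module_hom_add[OF h] left_module_hom_smult[OF h]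
        M.smult_closed N.smult_r_null)
qed

lemma left_submodule_zero:
  assumes "left_module R M"
  shows "left_submodule R {\<zero>\<^bsub>M\<^esub>} M"
proof -
  interpret M: left_module R M by fact
  show ?thesis
    by (auto simp: left_submodule_def M.smult_r_null)
qed

lemma left_module_hom_restrict_codomain:
  "\<lbrakk>h \<in> left_module_hom R M N; h ` carrier M \<subseteq> K\<rbrakk> \<Longrightarrow> h \<in> left_module_hom R M (N\<lparr>carrier := K\<rparr>)"
  by (auto simp: left_module_hom_def)

lemma left_module_hom_restrict_domain:
  "\<lbrakk>h \<in> left_module_hom R M N; K \<subseteq> carrier M\<rbrakk> \<Longrightarrow> h \<in> left_module_hom R (M\<lparr>carrier := K\<rparr>) N"
  by (auto simp: left_module_hom_def subset_iff Pi_iff)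

lemma left_module_hom_extend_codomain:
  "\<lbrakk>h \<in> left_module_hom R M (N\<lparr>carrier := K\<rparr>); K \<subseteq> carrier N\<rbrakk> \<Longrightarrow> h \<in> left_module_hom R M N"
  by (auto simp: left_module_hom_def)

subsection \<open>Transport of structure along an injection\<close>

text \<open>Free modules consist of functions, but projectivity and projective dimension are tested
  on modules with elements in \<open>univ\<close>. This construction makes the copies that live
  there.\<close>

definition transport :: "('a \<Rightarrow> 'b) \<Rightarrow> ('r, 'a) module \<Rightarrow> ('r, 'b) module"
  where "transport \<phi> M =
    \<lparr>carrier = \<phi> ` carrier M, mult = undefined, one = undefined, zero = \<phi> \<zero>\<^bsub>M\<^esub>,
     add = (\<lambda>x y. \<phi> (inv_into (carrier M) \<phi> x \<oplus>\<^bsub>M\<^esub> inv_into (carrier M) \<phi> y)),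
     smult = (\<lambda>a x. \<phi> (a \<odot>\<^bsub>M\<^esub> inv_into (carrier M) \<phi> x))\<rparr>"

lemma transport:
  assumes "left_module R M" and inj: "inj_on \<phi> (carrier M)"
  shows left_module_transport: "left_module R (transport \<phi> M)"
    and transport_hom: "\<phi> \<in> left_module_hom R M (transport \<phi> M)"
    and transport_inv_hom: "inv_into (carrier M) \<phi> \<in> left_module_hom R (transport \<phi> M) M"
proof -
  interpret M: left_module R M by fact
  have [simp]: "inv_into (carrier M) \<phi> (\<phi> x) = x" if "x \<in> carrier M" for x
    using inj that by simp
  show "left_module R (transport \<phi> M)"
    by (rule left_moduleI)
      (auto simp: transport_def M.a_ac M.smult_l_null M.smult_l_distr M.smult_r_distr
        M.smult_assoc M.smult_one M.smult_closed M.R.ring_axioms)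
  show "\<phi> \<in> left_module_hom R M (transport \<phi> M)"
    by (rule left_module_homI) (auto simp: transport_def)
  show "inv_into (carrier M) \<phi> \<in> left_module_hom R (transport \<phi> M) M"
    by (rule left_module_homI) (auto simp: transport_def M.smult_closed)
qed

section \<open>Free and projective modules\<close>

text \<open>The basis is the whole type \<open>'b\<close>, not a set, so no carrier condition on
  indices has to be maintained; basis elements outside a given carrier are later sent to
  zero.\<close>

definition free_module :: "('r, 'k) ring_scheme \<Rightarrow> ('r, 'b \<Rightarrow> 'r) module"
  where "free_module R =
    \<lparr>carrier = {f. (\<forall>b. f b \<in> carrier R) \<and> finite {b. f b \<noteq> \<zero>\<^bsub>R\<^esub>}}, mult = undefined, one = undefined,
     zero = (\<lambda>b. \<zero>\<^bsub>R\<^esub>), add = (\<lambda>f g b. f b \<oplus>\<^bsub>R\<^esub> g b), smult = (\<lambda>a f b. a \<otimes>\<^bsub>R\<^esub> f b)\<rparr>"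

definition unit_vector :: "('r, 'k) ring_scheme \<Rightarrow> 'b \<Rightarrow> 'b \<Rightarrow> 'r"
  where "unit_vector R b = (\<lambda>c. if c = b then \<one>\<^bsub>R\<^esub> else \<zero>\<^bsub>R\<^esub>)"

definition linear_extension :: "('r, 'k) ring_scheme \<Rightarrow> ('r, 'a) module \<Rightarrow> ('b \<Rightarrow> 'a) \<Rightarrow> ('b \<Rightarrow> 'r) \<Rightarrow> 'a"
  where "linear_extension R M \<phi> f = finsum M (\<lambda>b. f b \<odot>\<^bsub>M\<^esub> \<phi> b) {b. f b \<noteq> \<zero>\<^bsub>R\<^esub>}"

lemma left_module_free_module:
  assumes "ring R"
  shows "left_module R (free_module R)"
proof -
  interpret ring R by fact
  have fin_add: "finite {b. f b \<oplus>\<^bsub>R\<^esub> g b \<noteq> \<zero>\<^bsub>R\<^esub>}"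
    if "finite {b. f b \<noteq> \<zero>\<^bsub>R\<^esub>}" "finite {b. g b \<noteq> \<zero>\<^bsub>R\<^esub>}" for f g :: "'c \<Rightarrow> 'a"
    by (rule finite_subset[OF _ finite_UnI[OF that]]) auto
  have fin_smult: "finite {b. a \<otimes>\<^bsub>R\<^esub> f b \<noteq> \<zero>\<^bsub>R\<^esub>}"
    if "finite {b. f b \<noteq> \<zero>\<^bsub>R\<^esub>}" "a \<in> carrier R" for f :: "'c \<Rightarrow> 'a" and a
    by (rule finite_subset[OF _ that(1)]) (use that in auto)
  show ?thesis
    by (rule left_moduleI)
      (auto simp: free_module_def fun_eq_iff a_ac m_assoc l_distr r_distr fin_add fin_smult ring_axioms)
qed

lemma unit_vector_closed: "ring R \<Longrightarrow> unit_vector R b \<in> carrier (free_module R)"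
  by (auto simp: free_module_def unit_vector_def ring.ring_simprules
      intro: finite_subset[of _ "{b}"])

text \<open>The supports of f, g and f + g differ. Summing over a common finite superset, where the
  extra terms vanish, makes the three sums comparable.\<close>

lemma linear_extension_superset:
  assumes "left_module R M" "range \<phi> \<subseteq> carrier M" "f \<in> carrier (free_module R)"
    and "finite A" "{b. f b \<noteq> \<zero>\<^bsub>R\<^esub>} \<subseteq> A"
  shows "linear_extension R M \<phi> f = finsum M (\<lambda>b. f b \<odot>\<^bsub>M\<^esub> \<phi> b) A"
proof -
  interpret M: left_module R M by fact
  have [simp]: "\<phi> b \<in> carrier M" for b using assms(2) by auto
  show ?thesis
    unfolding linear_extension_def
    by (rule M.add.finprod_mono_neutral_cong_left)
      (use assms in \<open>auto simp: M.smult_l_null free_module_def intro!: M.smult_closed\<close>)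
qed

lemma linear_extension_hom:
  fixes R :: "('r, 'k) ring_scheme" and \<phi> :: "'b \<Rightarrow> 'a"
  assumes "left_module R M" and \<phi>: "range \<phi> \<subseteq> carrier M"
  shows "linear_extension R M \<phi> \<in> left_module_hom R (free_module R) M"
proof -
  interpret M: left_module R M by fact
  interpret F: left_module R "free_module R :: ('r, 'b \<Rightarrow> 'r) module"
    using M.R.ring_axioms by (rule left_module_free_module)
  note ext = linear_extension_superset[OF assms]
  have \<phi>c [simp]: "\<phi> b \<in> carrier M" for b using \<phi> by auto
  show ?thesis
  proof (rule left_module_homI)
    fix f g :: "'b \<Rightarrow> 'r"
    assume f: "f \<in> carrier (free_module R)" and g: "g \<in> carrier (free_module R)"
    then have [simp]: "f b \<in> carrier R" "g b \<in> carrier R" for b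
      by (auto simp: free_module_def)
    show "linear_extension R M \<phi> f \<in> carrier M"
      unfolding linear_extension_def using f by (intro M.finsum_closed) (simp add: M.smult_closed)
    let ?A = "{b. f b \<noteq> \<zero>\<^bsub>R\<^esub>} \<union> {b. g b \<noteq> \<zero>\<^bsub>R\<^esub>}"
    have A: "finite ?A" using f g by (auto simp: free_module_def)
    have fg: "(f \<oplus>\<^bsub>free_module R\<^esub> g) b = f b \<oplus>\<^bsub>R\<^esub> g b" for b
      by (simp add: free_module_def)
    have "linear_extension R M \<phi> (f \<oplus>\<^bsub>free_module R\<^esub> g) = (\<Oplus>\<^bsub>M\<^esub>b\<in>?A. (f b \<oplus>\<^bsub>R\<^esub> g b) \<odot>\<^bsub>M\<^esub> \<phi> b)"
      by (subst ext[OF F.a_closed[OF f g] A]) (use fg in auto)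
    also have "\<dots> = (\<Oplus>\<^bsub>M\<^esub>b\<in>?A. f b \<odot>\<^bsub>M\<^esub> \<phi> b \<oplus>\<^bsub>M\<^esub> g b \<odot>\<^bsub>M\<^esub> \<phi> b)"
      using f g by (simp add: M.smult_l_distr)
    also have "\<dots> = (\<Oplus>\<^bsub>M\<^esub>b\<in>?A. f b \<odot>\<^bsub>M\<^esub> \<phi> b) \<oplus>\<^bsub>M\<^esub> (\<Oplus>\<^bsub>M\<^esub>b\<in>?A. g b \<odot>\<^bsub>M\<^esub> \<phi> b)"
      using f g by (intro M.finsum_addf) (simp_all add: M.smult_closed)
    also have "\<dots> = linear_extension R M \<phi> f \<oplus>\<^bsub>M\<^esub> linear_extension R M \<phi> g"
      using ext[OF f A] ext[OF g A] by auto
    finally show "linear_extension R M \<phi> (f \<oplus>\<^bsub>free_module R\<^esub> g) =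
      linear_extension R M \<phi> f \<oplus>\<^bsub>M\<^esub> linear_extension R M \<phi> g" .
  next
    fix a and f :: "'b \<Rightarrow> 'r"
    assume a: "a \<in> carrier R" and f: "f \<in> carrier (free_module R)"
    then have [simp]: "f b \<in> carrier R" for b
      by (auto simp: free_module_def)
    let ?A = "{b. f b \<noteq> \<zero>\<^bsub>R\<^esub>}"
    have A: "finite ?A" using f by (auto simp: free_module_def)
    have af: "(a \<odot>\<^bsub>free_module R\<^esub> f) b = a \<otimes>\<^bsub>R\<^esub> f b" for b
      by (simp add: free_module_def)
    have "linear_extension R M \<phi> (a \<odot>\<^bsub>free_module R\<^esub> f) = (\<Oplus>\<^bsub>M\<^esub>b\<in>?A. (a \<otimes>\<^bsub>R\<^esub> f b) \<odot>\<^bsub>M\<^esub> \<phi> b)"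
      by (subst ext[OF F.smult_closed[OF a f] A]) (use a af in auto)
    also have "\<dots> = (\<Oplus>\<^bsub>M\<^esub>b\<in>?A. a \<odot>\<^bsub>M\<^esub> (f b \<odot>\<^bsub>M\<^esub> \<phi> b))"
      using a f by (simp add: M.smult_assoc)
    also have "\<dots> = a \<odot>\<^bsub>M\<^esub> linear_extension R M \<phi> f"
      unfolding linear_extension_def using a f A
      by (subst M.smult_finsum) (simp_all add: M.smult_closed)
    finally show "linear_extension R M \<phi> (a \<odot>\<^bsub>free_module R\<^esub> f) = a \<odot>\<^bsub>M\<^esub> linear_extension R M \<phi> f" .
  qed
qed

lemma linear_extension_unit_vector:
  assumes "left_module R M" and \<phi>: "range \<phi> \<subseteq> carrier M"
  shows "linear_extension R M \<phi> (unit_vector R b) = \<phi> b"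
proof -
  interpret M: left_module R M by fact
  have [simp]: "\<phi> b \<in> carrier M" for b using \<phi> by auto
  have "linear_extension R M \<phi> (unit_vector R b) = (\<Oplus>\<^bsub>M\<^esub>c\<in>{b}. unit_vector R b c \<odot>\<^bsub>M\<^esub> \<phi> c)"
    by (rule linear_extension_superset[OF assms unit_vector_closed])
      (auto simp: unit_vector_def M.R.ring_axioms)
  then show ?thesis
    by (simp add: unit_vector_def M.smult_one M.smult_closed)
qed

text \<open>Induction over a finite set that contains the support: clearing the coordinate
  \<open>a\<close> splits off a multiple of one unit vector.\<close>

lemma free_module_hom_eqI:
  fixes R :: "('r, 'k) ring_scheme" and g :: "('b \<Rightarrow> 'r) \<Rightarrow> 'a"
  assumes g: "g \<in> left_module_hom R (free_module R) M" and h: "h \<in> left_module_hom R (free_module R) M"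
    and M: "left_module R M" and eq: "\<And>b. g (unit_vector R b) = h (unit_vector R b)"
    and f: "f \<in> carrier (free_module R)"
  shows "g f = h f"
proof -
  interpret M: left_module R M by fact
  have F: "left_module R (free_module R :: ('r, 'b \<Rightarrow> 'r) module)"
    using M.R.ring_axioms by (rule left_module_free_module)
  have "\<lbrakk>finite A; f \<in> carrier (free_module R); {b. f b \<noteq> \<zero>\<^bsub>R\<^esub>} \<subseteq> A\<rbrakk> \<Longrightarrow> g f = h f" for A f
  proof (induction A arbitrary: f rule: finite_induct)
    case empty
    then have "f = \<zero>\<^bsub>free_module R\<^esub>"
      by (auto simp: free_module_def)
    then show ?case
      using left_module_hom_zero[OF g F M] left_module_hom_zero[OF h F M] by simp
  next
    case (insert a A)
    have fa: "f a \<in> carrier R"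
      using insert.prems by (auto simp: free_module_def)
    have f0: "f(a := \<zero>\<^bsub>R\<^esub>) \<in> carrier (free_module R)"
      using insert.prems by (auto simp: free_module_def intro: rev_finite_subset)
    have uv: "unit_vector R a \<in> carrier (free_module R)" "f a \<odot>\<^bsub>free_module R\<^esub> unit_vector R a \<in> carrier (free_module R)"
      by (simp_all add: unit_vector_closed[OF M.R.ring_axioms] left_module.smult_closed[OF F fa])
    have "f = f(a := \<zero>\<^bsub>R\<^esub>) \<oplus>\<^bsub>free_module R\<^esub> f a \<odot>\<^bsub>free_module R\<^esub> unit_vector R a"
      using insert.prems fa by (auto simp: free_module_def unit_vector_def fun_eq_iff)
    moreover have "g (f(a := \<zero>\<^bsub>R\<^esub>)) = h (f(a := \<zero>\<^bsub>R\<^esub>))"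
      by (rule insert.IH[OF f0]) (use insert.prems in auto)
    ultimately show ?case
      using left_module_hom_add[OF g f0 uv(2)] left_module_hom_add[OF h f0 uv(2)]
        left_module_hom_smult[OF g fa uv(1)] left_module_hom_smult[OF h fa uv(1)] eq by simp
  qed
  then show ?thesis using f by (auto simp: free_module_def)
qed

lemma free_module_lift:
  fixes f :: "('b \<Rightarrow> 'r) \<Rightarrow> 'd"
  assumes M: "left_module R M" and N: "left_module R N" and g: "g \<in> left_module_hom R M N"
    and surj: "g ` carrier M = carrier N" and f: "f \<in> left_module_hom R (free_module R) N"
  obtains h where "h \<in> left_module_hom R (free_module R) M"
    "\<forall>x\<in>carrier (free_module R). g (h x) = f x"
proof -
  interpret M: left_module R M by fact
  have "\<exists>m\<in>carrier M. g m = f (unit_vector R b)" for b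
    using surj left_module_hom_closed[OF f unit_vector_closed[OF M.R.ring_axioms, of b]] by (metis imageE)
  then obtain \<phi> where \<phi>: "range \<phi> \<subseteq> carrier M" "\<And>b. g (\<phi> b) = f (unit_vector R b)"
    by (metis image_subsetI)
  let ?h = "linear_extension R M \<phi>"
  have h: "?h \<in> left_module_hom R (free_module R) M"
    by (rule linear_extension_hom[OF M \<phi>(1)])
  have "g (?h x) = f x" if "x \<in> carrier (free_module R)" for x
    by (rule free_module_hom_eqI[OF left_module_hom_compose[OF h g] f N _ that])
      (simp add: linear_extension_unit_vector[OF M \<phi>(1)] \<phi>(2))
  then show thesis by (intro that[OF h] ballI)
qed

lemma free_module_cover:
  assumes M: "left_module R M"
  obtains p where "p \<in> left_module_hom R (free_module R :: ('r, 'a \<Rightarrow> 'r) module) M"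
    "p ` carrier (free_module R :: ('r, 'a \<Rightarrow> 'r) module) = carrier (M :: ('r, 'a) module)"
proof -
  interpret M: left_module R M by fact
  \<comment> \<open>The default value zero keeps the map inside the module on indices that are not
    elements of it.\<close>
  let ?\<phi> = "\<lambda>x. if x \<in> carrier M then x else \<zero>\<^bsub>M\<^esub>"
  have \<phi>: "range ?\<phi> \<subseteq> carrier M" by auto
  let ?p = "linear_extension R M ?\<phi>"
  have p: "?p \<in> left_module_hom R (free_module R) M"
    by (rule linear_extension_hom[OF M \<phi>])
  show thesis
  proof (rule that[OF p], intro equalityI subsetI)
    show "x \<in> carrier M" if "x \<in> ?p ` carrier (free_module R)" for x
      using that left_module_hom_closed[OF p] by auto
    show "x \<in> ?p ` carrier (free_module R)" if "x \<in> carrier M" for x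
      using linear_extension_unit_vector[OF M \<phi>, of x] that
      by (intro image_eqI[where x = "unit_vector R x"]) (simp_all add: unit_vector_closed[OF M.R.ring_axioms])
  qed
qed

subsection \<open>Embedding free modules into the universe\<close>

text \<open>The length prefix makes the code uniquely decodable.\<close>

fun encode :: "('r \<times> ('r, 'a) univ) list \<Rightarrow> ('r, 'a) univ"
  where "encode [] = []"
  | "encode ((r, u) # xs) = Inl r # Inr (Inr (length u)) # u @ encode xs"

lemma encode_inject: "encode xs = encode ys \<Longrightarrow> xs = ys"
proof (induction xs arbitrary: ys rule: encode.induct)
  case 1
  then show ?case by (cases ys rule: encode.cases) auto
next
  case (2 r u xs)
  then show ?case by (cases ys rule: encode.cases) auto
qed

text \<open>A finitely supported function is recovered from the finite set of its pairs (value, code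
  of index) with nonzero value. Some list enumerating this set is chosen, and \<open>encode\<close>
  turns it into an element of \<open>univ\<close>; the order of the list is irrelevant because its
  set already determines the function.\<close>

lemma free_module_embedding:
  fixes R :: "('r, 'k) ring_scheme" and c :: "'b \<Rightarrow> ('r, 'a) univ"
  assumes "inj c"
  obtains \<phi> :: "('b \<Rightarrow> 'r) \<Rightarrow> ('r, 'a) univ" where "inj_on \<phi> (carrier (free_module R))"
proof -
  define l where "l f = (SOME xs. set xs = (\<lambda>b. (f b, c b)) ` {b. f b \<noteq> \<zero>\<^bsub>R\<^esub>})" for f
  have l: "set (l f) = (\<lambda>b. (f b, c b)) ` {b. f b \<noteq> \<zero>\<^bsub>R\<^esub>}" if "f \<in> carrier (free_module R)" for f
    unfolding l_def by (rule someI_ex, rule finite_list, rule finite_imageI)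
      (use that in \<open>simp add: free_module_def\<close>)
  have mem: "(r, c b) \<in> set (l h) \<longleftrightarrow> r = h b \<and> r \<noteq> \<zero>\<^bsub>R\<^esub>"
    if "h \<in> carrier (free_module R)" for h r b
    using \<open>inj c\<close> by (auto simp: l[OF that] inj_eq)
  have "inj_on (\<lambda>f. encode (l f)) (carrier (free_module R))"
  proof (rule inj_onI, rule ext)
    fix f g b
    assume f: "f \<in> carrier (free_module R)" and g: "g \<in> carrier (free_module R)"
      and "encode (l f) = encode (l g)"
    from this(3) have "l f = l g"
      by (rule encode_inject)
    then have "r = f b \<and> r \<noteq> \<zero>\<^bsub>R\<^esub> \<longleftrightarrow> r = g b \<and> r \<noteq> \<zero>\<^bsub>R\<^esub>" for r
      using mem[OF f, of r b] mem[OF g, of r b] by simp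
    from this[of "f b"] this[of "g b"] show "f b = g b"
      by (cases "f b = \<zero>\<^bsub>R\<^esub>") auto
  qed
  then show thesis by (rule that)
qed

subsection \<open>Projective modules\<close>

lemma projective_imp_left_module: "projective_module R P \<Longrightarrow> left_module R P"
  by (simp add: projective_module_def)

text \<open>Here the size of the test type is used: the free cover of P and P itself both have
  copies in \<open>univ\<close>. Projectivity lifts the copy map of P along the copied cover, and
  undoing the copying gives a section of the cover.\<close>

lemma projective_module_retract_of_free:
  fixes R :: "('r, 'k) ring_scheme" and P :: "('r, 'a) module"
  assumes "projective_module R P"
  obtains i :: "'a \<Rightarrow> 'a \<Rightarrow> 'r" and p
  where "i \<in> left_module_hom R P (free_module R)" "p \<in> left_module_hom R (free_module R) P"
    "\<forall>x\<in>carrier P. p (i x) = x"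
proof -
  have P: "left_module R P" using assms by (rule projective_imp_left_module)
  then interpret P: left_module R P .
  let ?F = "free_module R :: ('r, 'a \<Rightarrow> 'r) module"
  have F: "left_module R ?F"
    by (rule left_module_free_module[OF P.R.ring_axioms])
  obtain p where p: "p \<in> left_module_hom R ?F P" "p ` carrier ?F = carrier P"
    by (rule free_module_cover[OF P])
  define c :: "'a \<Rightarrow> ('r, 'a) univ" where "c x = [Inr (Inl x)]" for x
  have c: "inj c" by (auto simp: c_def inj_def)
  obtain \<phi> :: "('a \<Rightarrow> 'r) \<Rightarrow> ('r, 'a) univ" where \<phi>: "inj_on \<phi> (carrier ?F)"
    by (rule free_module_embedding[OF c])
  have c': "inj_on c (carrier P)" using c by (rule inj_on_subset) simp
  note tF = transport[OF F \<phi>] and tP = transport[OF P c']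
  let ?g = "\<lambda>u. c (p (inv_into (carrier ?F) \<phi> u))"
  have g: "?g \<in> left_module_hom R (transport \<phi> ?F) (transport c P)"
    by (intro left_module_hom_compose[OF _ tP(2)] left_module_hom_compose[OF tF(3) p(1)])
  have "?g ` carrier (transport \<phi> ?F) = carrier (transport c P)"
    using p(2) \<phi> by (simp add: transport_def image_image flip: image_image[of c p])
  then obtain h where h: "h \<in> left_module_hom R P (transport \<phi> ?F)"
    "\<And>x. x \<in> carrier P \<Longrightarrow> ?g (h x) = c x"
    using assms tF(1) tP(1) g tP(2) unfolding projective_module_def by blast
  show thesis
  proof
    show "(\<lambda>x. inv_into (carrier ?F) \<phi> (h x)) \<in> left_module_hom R P ?F"
      by (rule left_module_hom_compose[OF h(1) tF(3)])
    show "\<forall>x\<in>carrier P. p (inv_into (carrier ?F) \<phi> (h x)) = x"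
      using h(2) c by (simp add: inj_eq)
  qed (rule p(1))
qed

text \<open>Retracts of free modules lift against modules of every type, so that the restriction to one
  type in the definition of projectivity disappears.\<close>

lemma projective_lift:
  fixes R :: "('r, 'k) ring_scheme" and P :: "('r, 'a) module"
  assumes P: "projective_module R P" and M: "left_module R M" and N: "left_module R N"
    and g: "g \<in> left_module_hom R M N" "g ` carrier M = carrier N" and f: "f \<in> left_module_hom R P N"
  obtains h where "h \<in> left_module_hom R P M" "\<forall>x\<in>carrier P. g (h x) = f x"
proof -
  obtain i :: "'a \<Rightarrow> 'a \<Rightarrow> 'r" and p where ip: "i \<in> left_module_hom R P (free_module R)" "p \<in> left_module_hom R (free_module R) P"
    "\<forall>x\<in>carrier P. p (i x) = x"
    by (rule projective_module_retract_of_free[OF P])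
  obtain h where h: "h \<in> left_module_hom R (free_module R) M"
    "\<forall>x\<in>carrier (free_module R). g (h x) = f (p x)"
    by (rule free_module_lift[OF M N g left_module_hom_compose[OF ip(2) f]])
  show thesis
    by (rule that[OF left_module_hom_compose[OF ip(1) h(1)]])
      (simp add: h(2) left_module_hom_closed[OF ip(1)] ip(3))
qed

text \<open>Shrinking the codomain to the image of g makes g surjective. This is the form in which
  exactness gets used: it places the values of f in the image of a differential.\<close>

lemma projective_lift_into_image:
  assumes P: "projective_module R P" and M: "left_module R M" and N: "left_module R N"
    and g: "g \<in> left_module_hom R M N" and f: "f \<in> left_module_hom R P N"
    and sub: "f ` carrier P \<subseteq> g ` carrier M"
  obtains h where "h \<in> left_module_hom R P M" "\<forall>x\<in>carrier P. g (h x) = f x"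
proof -
  let ?N = "N\<lparr>carrier := g ` carrier M\<rparr>"
  have N': "left_module R ?N"
    by (rule left_module_submodule[OF N left_submodule_image[OF g M N]])
  have "g \<in> left_module_hom R M ?N" "f \<in> left_module_hom R P ?N"
    using g f sub by (auto intro: left_module_hom_restrict_codomain)
  then show thesis
    using projective_lift[OF P M N', of g f] that by auto
qed

text \<open>P and Q may have different types of elements, hence different test types in the
  definition of projectivity. Lifting P against modules of every type bridges the two.\<close>

lemma projective_module_retract:
  assumes P: "projective_module R P" and Q: "left_module R Q"
    and i: "i \<in> left_module_hom R Q P" and p: "p \<in> left_module_hom R P Q"
    and pi: "\<And>x. x \<in> carrier Q \<Longrightarrow> p (i x) = x"
  shows "projective_module R Q"
  unfolding projective_module_def
proof (intro conjI allI impI Q, elim conjE)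
  fix M N :: "('a, ('a, 'e) univ) module" and g f
  assume M: "left_module R M" and N: "left_module R N" and g: "g \<in> left_module_hom R M N"
    "g ` carrier M = carrier N" and f: "f \<in> left_module_hom R Q N"
  obtain h where h: "h \<in> left_module_hom R P M" "\<forall>x\<in>carrier P. g (h x) = f (p x)"
    by (rule projective_lift[OF P M N g left_module_hom_compose[OF p f]])
  show "\<exists>h\<in>left_module_hom R Q M. \<forall>x\<in>carrier Q. g (h x) = f x"
    using left_module_hom_compose[OF i h(1)] h(2) left_module_hom_closed[OF i] pi by fastforce
qed

lemma projective_free_module:
  assumes "ring R"
  shows "projective_module R (free_module R)"
  unfolding projective_module_def
proof (intro conjI allI impI left_module_free_module[OF assms], elim conjE)
  fix M N :: "('a, ('a, 'c \<Rightarrow> 'a) univ) module" and g and f :: "('c \<Rightarrow> 'a) \<Rightarrow> _"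
  assume "left_module R M" "left_module R N" "g \<in> left_module_hom R M N"
    "g ` carrier M = carrier N" "f \<in> left_module_hom R (free_module R) N"
  then obtain h where "h \<in> left_module_hom R (free_module R) M"
    "\<forall>x\<in>carrier (free_module R). g (h x) = f x"
    by (rule free_module_lift)
  then show "\<exists>h\<in>left_module_hom R (free_module R) M. \<forall>x\<in>carrier (free_module R). g (h x) = f x"
    by blast
qed

text \<open>The cover always lands in \<open>univ\<close>. For a module already in
  \<open>univ\<close> the identity serves as c, so that covering can be iterated without changing
  the type.\<close>

lemma projective_cover:
  fixes R :: "('r, 'k) ring_scheme" and M :: "('r, 'b) module" and c :: "'b \<Rightarrow> ('r, 'a) univ"
  assumes M: "left_module R M" and c: "inj c"
  obtains F :: "('r, ('r, 'a) univ) module" and p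
  where "projective_module R F" "p \<in> left_module_hom R F M" "p ` carrier F = carrier M"
proof -
  interpret M: left_module R M by fact
  let ?F = "free_module R :: ('r, 'b \<Rightarrow> 'r) module"
  have F: "left_module R ?F" by (rule left_module_free_module[OF M.R.ring_axioms])
  obtain p where p: "p \<in> left_module_hom R ?F M" "p ` carrier ?F = carrier M"
    by (rule free_module_cover[OF M])
  obtain \<phi> :: "('b \<Rightarrow> 'r) \<Rightarrow> ('r, 'a) univ" where \<phi>: "inj_on \<phi> (carrier ?F)"
    by (rule free_module_embedding[OF c])
  note t = transport[OF F \<phi>]
  show thesis
  proof
    show "projective_module R (transport \<phi> ?F)"
      by (rule projective_module_retract[OF projective_free_module[OF M.R.ring_axioms] t(1,3,2)])
        (simp add: transport_def f_inv_into_f)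
    show "(\<lambda>u. p (inv_into (carrier ?F) \<phi> u)) \<in> left_module_hom R (transport \<phi> ?F) M"
      by (rule left_module_hom_compose[OF t(3) p(1)])
    show "(\<lambda>u. p (inv_into (carrier ?F) \<phi> u)) ` carrier (transport \<phi> ?F) = carrier M"
      using p(2) \<phi> by (simp add: transport_def image_image)
  qed
qed

section \<open>Projective resolutions\<close>

lemma projective_resolutionD:
  assumes "projective_resolution R P d e X"
  shows "projective_module R (P i)" and "left_module R (P i)"
    and "d i \<in> left_module_hom R (P (Suc i)) (P i)"
    and "e \<in> left_module_hom R (P 0) X" and "e ` carrier (P 0) = carrier X"
    and "x \<in> carrier (P (Suc 0)) \<Longrightarrow> e (d 0 x) = \<zero>\<^bsub>X\<^esub>"
    and "\<lbrakk>x \<in> carrier (P 0); e x = \<zero>\<^bsub>X\<^esub>\<rbrakk> \<Longrightarrow> x \<in> d 0 ` carrier (P (Suc 0))"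
    and "x \<in> carrier (P (Suc (Suc i))) \<Longrightarrow> d i (d (Suc i) x) = \<zero>\<^bsub>P i\<^esub>"
    and "\<lbrakk>x \<in> carrier (P (Suc i)); d i x = \<zero>\<^bsub>P i\<^esub>\<rbrakk> \<Longrightarrow> x \<in> d (Suc i) ` carrier (P (Suc (Suc i)))"
proof -
  have 1: "\<And>i. projective_module R (P i)" and 2: "\<And>i. d i \<in> left_module_hom R (P (Suc i)) (P i)"
    and 3: "e \<in> left_module_hom R (P 0) X" "e ` carrier (P 0) = carrier X"
    and 4: "a_kernel (P 0) X e = d 0 ` carrier (P (Suc 0))"
    and 5: "\<And>i. a_kernel (P (Suc i)) (P i) (d i) = d (Suc i) ` carrier (P (Suc (Suc i)))"
    using assms by (simp_all add: projective_resolution_def)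
  show "projective_module R (P i)" by (rule 1)
  show "left_module R (P i)" by (rule projective_imp_left_module[OF 1])
  show "d i \<in> left_module_hom R (P (Suc i)) (P i)" by (rule 2)
  show "e \<in> left_module_hom R (P 0) X" "e ` carrier (P 0) = carrier X" by (rule 3)+
  show "e (d 0 x) = \<zero>\<^bsub>X\<^esub>" if "x \<in> carrier (P (Suc 0))"
    using equalityD2[OF 4] that by (auto simp: a_kernel_def')
  show "x \<in> d 0 ` carrier (P (Suc 0))" if "x \<in> carrier (P 0)" "e x = \<zero>\<^bsub>X\<^esub>"
    using equalityD1[OF 4] that by (auto simp: a_kernel_def')
  show "d i (d (Suc i) x) = \<zero>\<^bsub>P i\<^esub>" if "x \<in> carrier (P (Suc (Suc i)))"
    using equalityD2[OF 5[of i]] that by (auto simp: a_kernel_def')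
  show "x \<in> d (Suc i) ` carrier (P (Suc (Suc i)))" if "x \<in> carrier (P (Suc i))" "d i x = \<zero>\<^bsub>P i\<^esub>"
    using equalityD1[OF 5[of i]] that by (auto simp: a_kernel_def')
qed

lemma projective_resolutionI:
  assumes "\<And>i. projective_module R (P i)"
    and "\<And>i. d i \<in> left_module_hom R (P (Suc i)) (P i)"
    and "e \<in> left_module_hom R (P 0) X"
    and "e ` carrier (P 0) = carrier X"
    and "a_kernel (P 0) X e = d 0 ` carrier (P (Suc 0))"
    and "\<And>i. a_kernel (P (Suc i)) (P i) (d i) = d (Suc i) ` carrier (P (Suc (Suc i)))"
  shows "projective_resolution R P d e X"
  using assms by (auto simp: projective_resolution_def)

lemma projective_resolution_exists:
  fixes R :: "('r, 'k) ring_scheme" and X :: "('r, 'a) module"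
  assumes X: "left_module R X"
  obtains P :: "nat \<Rightarrow> ('r, ('r, 'a) univ) module" and d e where "projective_resolution R P d e X"
proof -
  define c :: "'a \<Rightarrow> ('r, 'a) univ" where "c x = [Inr (Inl x)]" for x
  have "inj c" by (auto simp: c_def inj_def)
  obtain F0 :: "('r, ('r, 'a) univ) module" and e where F0: "projective_module R F0"
    "e \<in> left_module_hom R F0 X" "e ` carrier F0 = carrier X"
    by (rule projective_cover[OF X \<open>inj c\<close>])
  \<comment> \<open>Covers are chosen for all records K at once, with the module property as a
    premise: the recursion below needs a total function and cannot carry that property
    along.\<close>
  have "\<exists>Fp :: ('r, ('r, 'a) univ) module \<times> (('r, 'a) univ \<Rightarrow> ('r, 'a) univ). left_module R K \<longrightarrow>
      projective_module R (fst Fp) \<and> snd Fp \<in> left_module_hom R (fst Fp) K \<and>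
      snd Fp ` carrier (fst Fp) = carrier K" for K :: "('r, ('r, 'a) univ) module"
  proof (cases "left_module R K")
    case True
    obtain F :: "('r, ('r, 'a) univ) module" and p where "projective_module R F"
      "p \<in> left_module_hom R F K" "p ` carrier F = carrier K"
      by (rule projective_cover[OF True inj_on_id])
    then show ?thesis by (intro exI[of _ "(F, p)"]) simp
  qed simp
  from choice[OF allI[OF this]] obtain Fp :: "('r, ('r, 'a) univ) module \<Rightarrow>
      ('r, ('r, 'a) univ) module \<times> (('r, 'a) univ \<Rightarrow> ('r, 'a) univ)"
    where Fp: "\<forall>K. left_module R K \<longrightarrow> projective_module R (fst (Fp K)) \<and>
      snd (Fp K) \<in> left_module_hom R (fst (Fp K)) K \<and> snd (Fp K) ` carrier (fst (Fp K)) = carrier K"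
    by (rule exE)
  \<comment> \<open>The syzygies: K 0 is the kernel of the augmentation, P (i + 1) is the chosen
    cover of K i, and K (i + 1) is the kernel of that cover.\<close>
  define K where "K = rec_nat (F0\<lparr>carrier := a_kernel F0 X e\<rparr>)
    (\<lambda>_ K. (fst (Fp K))\<lparr>carrier := a_kernel (fst (Fp K)) K (snd (Fp K))\<rparr>)"
  define P where "P i = (case i of 0 \<Rightarrow> F0 | Suc j \<Rightarrow> fst (Fp (K j)))" for i
  define d where "d i = snd (Fp (K i))" for i
  have K_Suc: "K (Suc i) = (P (Suc i))\<lparr>carrier := a_kernel (P (Suc i)) (K i) (d i)\<rparr>" for i
    by (simp add: K_def P_def d_def)
  \<comment> \<open>As records, K i and P i differ only in the carrier, so the cover of K i can also
    be read as a map into P i.\<close>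
  have K: "left_module R (K i) \<and> left_submodule R (carrier (K i)) (P i) \<and> K i = (P i)\<lparr>carrier := carrier (K i)\<rparr>" for i
  proof (induction i)
    case 0
    have "left_submodule R (a_kernel F0 X e) F0"
      using F0 X by (intro left_submodule_kernel) (auto dest: projective_imp_left_module)
    then show ?case
      using F0 by (auto simp: K_def P_def intro!: left_module_submodule dest: projective_imp_left_module)
  next
    case (Suc i)
    then have *: "left_module R (P (Suc i))" "d i \<in> left_module_hom R (P (Suc i)) (K i)"
      using Fp[rule_format, of "K i"] by (auto simp: P_def d_def dest: projective_imp_left_module)
    then have "left_submodule R (a_kernel (P (Suc i)) (K i) (d i)) (P (Suc i))"
      using Suc by (intro left_submodule_kernel) auto
    then show ?case
      using * by (auto simp: K_Suc intro!: left_module_submodule)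
  qed
  have zero: "\<zero>\<^bsub>K i\<^esub> = \<zero>\<^bsub>P i\<^esub>" for i
    using arg_cong[of "K i" _ zero, OF K[of i, THEN conjunct2, THEN conjunct2]] by simp
  have Fp': "projective_module R (P (Suc i))" "d i \<in> left_module_hom R (P (Suc i)) (K i)"
    "d i ` carrier (P (Suc i)) = carrier (K i)" for i
    using Fp[rule_format, of "K i"] K[of i] by (auto simp: P_def d_def)
  have "projective_resolution R P d e X"
  proof (rule projective_resolutionI)
    show "projective_module R (P i)" for i
      using Fp'(1) F0(1) by (cases i) (auto simp: P_def)
    show "d i \<in> left_module_hom R (P (Suc i)) (P i)" for i
      using Fp'(2)[of i] K[of i] left_module_hom_extend_codomain[of "d i" R "P (Suc i)" "carrier (K i)" "P i"]
      by (simp add: left_submodule_def)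
    show "e \<in> left_module_hom R (P 0) X" "e ` carrier (P 0) = carrier X"
      using F0 by (auto simp: P_def)
    show "a_kernel (P 0) X e = d 0 ` carrier (P (Suc 0))"
      by (simp add: Fp'(3)) (simp add: K_def P_def)
    show "a_kernel (P (Suc i)) (P i) (d i) = d (Suc i) ` carrier (P (Suc (Suc i)))" for i
      by (simp add: Fp'(3)) (simp add: K_Suc a_kernel_def' zero)
  qed
  then show thesis by (rule that)
qed

section \<open>Comparison of resolutions, and projective dimension read off from a splitting\<close>

lemma resolution_comparison:
  assumes P: "projective_resolution R P d e X" and Q: "projective_resolution R Q d' e' X"
    and X: "left_module R X"
  obtains f where "\<forall>i. f i \<in> left_module_hom R (P i) (Q i)"
    "\<forall>x\<in>carrier (P 0). e' (f 0 x) = e x"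
    "\<forall>i. \<forall>x\<in>carrier (P (Suc i)). d' i (f (Suc i) x) = f i (d i x)"
proof -
  note PD = projective_resolutionD[OF P] and QD = projective_resolutionD[OF Q]
  \<comment> \<open>The second clause is what permits the next lift: f (d n x) has to lie in the
    image of d' n. Exactness of Q reproduces the clause one degree higher.\<close>
  define I where "I n f \<longleftrightarrow> f \<in> left_module_hom R (P n) (Q n) \<and>
      (\<lambda>x. f (d n x)) ` carrier (P (Suc n)) \<subseteq> d' n ` carrier (Q (Suc n)) \<and>
      (n = 0 \<longrightarrow> (\<forall>x\<in>carrier (P 0). e' (f x) = e x))" for n f
  have "\<exists>f. \<forall>n. I n (f n) \<and> (\<forall>x\<in>carrier (P (Suc n)). d' n (f (Suc n) x) = f n (d n x))"
  proof (rule dependent_nat_choice)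
    obtain f where f: "f \<in> left_module_hom R (P 0) (Q 0)" "\<forall>x\<in>carrier (P 0). e' (f x) = e x"
      by (rule projective_lift[OF PD(1) QD(2) X QD(4,5) PD(4)])
    have "f (d 0 x) \<in> d' 0 ` carrier (Q (Suc 0))" if x: "x \<in> carrier (P (Suc 0))" for x
    proof (rule QD(7))
      have dx: "d 0 x \<in> carrier (P 0)" using PD(3) x by (rule left_module_hom_closed)
      show "f (d 0 x) \<in> carrier (Q 0)" using f(1) dx by (rule left_module_hom_closed)
      show "e' (f (d 0 x)) = \<zero>\<^bsub>X\<^esub>" using f(2) dx PD(6)[OF x] by simp
    qed
    then show "\<exists>f. I 0 f"
      using f by (auto simp: I_def)
  next
    fix f n
    assume "I n f"
    then have f: "f \<in> left_module_hom R (P n) (Q n)"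
      and sub: "(\<lambda>x. f (d n x)) ` carrier (P (Suc n)) \<subseteq> d' n ` carrier (Q (Suc n))"
      by (auto simp: I_def)
    obtain g where g: "g \<in> left_module_hom R (P (Suc n)) (Q (Suc n))"
      "\<forall>x\<in>carrier (P (Suc n)). d' n (g x) = f (d n x)"
      by (rule projective_lift_into_image[OF PD(1) QD(2) QD(2) QD(3) left_module_hom_compose[OF PD(3) f] sub])
    have "g (d (Suc n) x) \<in> d' (Suc n) ` carrier (Q (Suc (Suc n)))" if x: "x \<in> carrier (P (Suc (Suc n)))" for x
    proof (rule QD(9))
      have dx: "d (Suc n) x \<in> carrier (P (Suc n))" using PD(3) x by (rule left_module_hom_closed)
      show "g (d (Suc n) x) \<in> carrier (Q (Suc n))" using g(1) dx by (rule left_module_hom_closed)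
      show "d' n (g (d (Suc n) x)) = \<zero>\<^bsub>Q n\<^esub>"
        using g(2) dx PD(8)[OF x] left_module_hom_zero[OF f PD(2) QD(2)] by simp
    qed
    then show "\<exists>g. I (Suc n) g \<and> (\<forall>x\<in>carrier (P (Suc n)). d' n (g x) = f (d n x))"
      using g by (auto simp: I_def)
  qed
  then obtain f where "\<forall>n. I n (f n) \<and> (\<forall>x\<in>carrier (P (Suc n)). d' n (f (Suc n) x) = f n (d n x))"
    by (rule exE)
  then show thesis
    by (intro that[of f]) (auto simp: I_def)
qed

text \<open>The image of \<open>d n\<close> is a direct summand of \<open>P n\<close> (with complementary projection \<open>\<sigma>\<close>), or
  equivalently the cokernel of \<open>d n\<close>, which is the \<open>n\<close>-th syzygy, is projective.\<close>

definition splits_at ::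
    "('r, 'k) ring_scheme \<Rightarrow> (nat \<Rightarrow> ('r, 'p) module) \<Rightarrow> (nat \<Rightarrow> 'p \<Rightarrow> 'p) \<Rightarrow> nat \<Rightarrow> bool"
  where "splits_at R P d n \<longleftrightarrow> (\<exists>\<sigma>\<in>left_module_hom R (P n) (P n).
    (\<forall>x\<in>carrier (P (Suc n)). \<sigma> (d n x) = \<zero>\<^bsub>P n\<^esub>) \<and>
    (\<forall>x\<in>carrier (P n). x \<ominus>\<^bsub>P n\<^esub> \<sigma> x \<in> d n ` carrier (P (Suc n))))"

text \<open>Compare both ways, by f : P \<rightarrow> Q and g : Q \<rightarrow> P. The composite f g
  is homotopic to the identity, so a correction of f g in degree n differs from the identity by
  boundaries. Since P vanishes in degree n + 1, g kills the boundaries of Q in degree n, and so does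
  the correction. P and Q may have different types of elements.\<close>

lemma finite_resolution_splits_at:
  assumes P: "projective_resolution R P d e X" and Q: "projective_resolution R Q d' e' X"
    and X: "left_module R X" and n: "carrier (P (Suc n)) = {\<zero>\<^bsub>P (Suc n)\<^esub>}"
  shows "splits_at R Q d' n"
proof -
  note PD = projective_resolutionD[OF P] and QD = projective_resolutionD[OF Q]
  obtain f where f': "\<forall>i. f i \<in> left_module_hom R (P i) (Q i)"
    "\<forall>x\<in>carrier (P 0). e' (f 0 x) = e x"
    "\<forall>i. \<forall>x\<in>carrier (P (Suc i)). d' i (f (Suc i) x) = f i (d i x)"
    by (rule resolution_comparison[OF P Q X])
  obtain g where g': "\<forall>i. g i \<in> left_module_hom R (Q i) (P i)"
    "\<forall>x\<in>carrier (Q 0). e (g 0 x) = e' x"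
    "\<forall>i. \<forall>x\<in>carrier (Q (Suc i)). d i (g (Suc i) x) = g i (d' i x)"
    by (rule resolution_comparison[OF Q P X])
  note f = f'[rule_format] and g = g'[rule_format]
  note closed = left_module_hom_closed[OF f(1)] left_module_hom_closed[OF g(1)]
    left_module_hom_closed[OF PD(3)] left_module_hom_closed[OF QD(3)]
  have fg: "(\<lambda>x. f i (g i x)) \<in> left_module_hom R (Q i) (Q i)" for i
    by (rule left_module_hom_compose[OF g(1) f(1)])
  \<comment> \<open>In degree 0 the map \<sigma> is f g. The next one is f g + h d', where h lifts 1
    - \<sigma> through d'. The summand h d' vanishes on boundaries, so the new map still agrees with
    f g there; this agreement in degree k is what makes x - (f g x + h (d' x)) a cycle in degree k +
    1.\<close>
  define H where "H k \<sigma> \<longleftrightarrow> \<sigma> \<in> left_module_hom R (Q k) (Q k) \<and>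
      (\<forall>x\<in>carrier (Q (Suc k)). \<sigma> (d' k x) = f k (g k (d' k x))) \<and>
      (\<forall>x\<in>carrier (Q k). x \<ominus>\<^bsub>Q k\<^esub> \<sigma> x \<in> d' k ` carrier (Q (Suc k)))" for k \<sigma>
  have "\<exists>\<sigma>. H k \<sigma>" for k
  proof (induction k)
    case 0
    interpret Q0: left_module R "Q 0" by (rule QD(2))
    interpret X: left_module R X by (rule X)
    have "x \<ominus>\<^bsub>Q 0\<^esub> f 0 (g 0 x) \<in> d' 0 ` carrier (Q (Suc 0))" if x: "x \<in> carrier (Q 0)" for x
    proof (rule QD(7))
      show "e' (x \<ominus>\<^bsub>Q 0\<^esub> f 0 (g 0 x)) = \<zero>\<^bsub>X\<^esub>"
        using left_module_hom_diff[OF QD(4) QD(2) X x, of "f 0 (g 0 x)"] left_module_hom_closed[OF QD(4) x]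
        by (simp add: closed x f g X.minus_self)
    qed (simp add: closed x)
    then have "H 0 (\<lambda>x. f 0 (g 0 x))"
      using fg by (simp add: H_def)
    then show ?case by (rule exI[of "H 0"])
  next
    case (Suc k)
    interpret Qk: left_module R "Q k" by (rule QD(2))
    interpret QSk: left_module R "Q (Suc k)" by (rule QD(2))
    from Suc obtain \<sigma> where "H k \<sigma>" by (rule exE)
    then have \<sigma>: "\<sigma> \<in> left_module_hom R (Q k) (Q k)"
      "\<And>x. x \<in> carrier (Q (Suc k)) \<Longrightarrow> \<sigma> (d' k x) = f k (g k (d' k x))"
      "\<And>x. x \<in> carrier (Q k) \<Longrightarrow> x \<ominus>\<^bsub>Q k\<^esub> \<sigma> x \<in> d' k ` carrier (Q (Suc k))"
      by (simp_all add: H_def)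
    have "(\<lambda>x. x \<ominus>\<^bsub>Q k\<^esub> \<sigma> x) ` carrier (Q k) \<subseteq> d' k ` carrier (Q (Suc k))"
      using \<sigma>(3) by blast
    then obtain h where h: "h \<in> left_module_hom R (Q k) (Q (Suc k))"
      "\<forall>x\<in>carrier (Q k). d' k (h x) = x \<ominus>\<^bsub>Q k\<^esub> \<sigma> x"
      by (rule projective_lift_into_image[OF QD(1) QD(2) QD(2) QD(3)
            left_module_hom_minus[OF left_module_hom_id \<sigma>(1) QD(2)]])
    note closed = closed left_module_hom_closed[OF h(1)] left_module_hom_closed[OF \<sigma>(1)]
    let ?\<tau> = "\<lambda>x. f (Suc k) (g (Suc k) x) \<oplus>\<^bsub>Q (Suc k)\<^esub> h (d' k x)"
    have \<tau>: "?\<tau> \<in> left_module_hom R (Q (Suc k)) (Q (Suc k))"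
      by (rule left_module_hom_plus[OF fg left_module_hom_compose[OF QD(3) h(1)] QD(2)])
    have "?\<tau> (d' (Suc k) x) = f (Suc k) (g (Suc k) (d' (Suc k) x))" if x: "x \<in> carrier (Q (Suc (Suc k)))" for x
      using x by (simp add: QD(8) left_module_hom_zero[OF h(1) QD(2) QD(2)] closed)
    moreover have "x \<ominus>\<^bsub>Q (Suc k)\<^esub> ?\<tau> x \<in> d' (Suc k) ` carrier (Q (Suc (Suc k)))"
      if x: "x \<in> carrier (Q (Suc k))" for x
    proof (rule QD(9))
      have "d' k (x \<ominus>\<^bsub>Q (Suc k)\<^esub> ?\<tau> x) = d' k x \<ominus>\<^bsub>Q k\<^esub> d' k (?\<tau> x)"
        by (rule left_module_hom_diff[OF QD(3) QD(2) QD(2)]) (simp_all add: x closed)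
      also have "d' k (?\<tau> x) = f k (g k (d' k x)) \<oplus>\<^bsub>Q k\<^esub> (d' k x \<ominus>\<^bsub>Q k\<^esub> \<sigma> (d' k x))"
        by (subst left_module_hom_add[OF QD(3)]) (simp_all add: x closed f g h)
      also have "\<dots> = d' k x"
        using x closed by (simp add: \<sigma>(2) a_minus_def Qk.a_lcomm Qk.r_neg)
      finally show "d' k (x \<ominus>\<^bsub>Q (Suc k)\<^esub> ?\<tau> x) = \<zero>\<^bsub>Q k\<^esub>"
        by (simp add: x closed Qk.minus_self)
    qed (simp add: x closed)
    ultimately have "H (Suc k) ?\<tau>"
      using \<tau> by (simp add: H_def)
    then show ?case by (rule exI[of "H (Suc k)"])
  qed
  from this[of n] obtain \<sigma> where "H n \<sigma>" by (rule exE)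
  then have \<sigma>: "\<sigma> \<in> left_module_hom R (Q n) (Q n)"
      "\<And>x. x \<in> carrier (Q (Suc n)) \<Longrightarrow> \<sigma> (d' n x) = f n (g n (d' n x))"
      "\<And>x. x \<in> carrier (Q n) \<Longrightarrow> x \<ominus>\<^bsub>Q n\<^esub> \<sigma> x \<in> d' n ` carrier (Q (Suc n))"
    by (simp_all add: H_def)
  have "\<sigma> (d' n x) = \<zero>\<^bsub>Q n\<^esub>" if x: "x \<in> carrier (Q (Suc n))" for x
  proof -
    have "g (Suc n) x = \<zero>\<^bsub>P (Suc n)\<^esub>"
      using closed(2)[OF x] n by simp
    then have "g n (d' n x) = \<zero>\<^bsub>P n\<^esub>"
      using g(3)[OF x] left_module_hom_zero[OF PD(3) PD(2) PD(2)] by metis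
    then show ?thesis
      using \<sigma>(2)[OF x] left_module_hom_zero[OF f(1) PD(2) QD(2)] by simp
  qed
  then show ?thesis
    unfolding splits_at_def using \<sigma> by (intro bexI[of _ \<sigma>]) simp_all
qed

text \<open>As \<sigma> kills the image of d n and x - \<sigma> x lies in it, \<sigma> is idempotent
  and its image is a complement. This complement is a projective copy of the cokernel of d n, and
  the resolution is truncated with it in degree n.\<close>

lemma splits_at_imp_finite_resolution:
  fixes P :: "nat \<Rightarrow> ('r, 'p) module"
  assumes P: "projective_resolution R P d e X" and X: "left_module R X" and "splits_at R P d n"
  obtains P' :: "nat \<Rightarrow> ('r, 'p) module" and d' e' where "projective_resolution R P' d' e' X"
    "\<forall>i>n. carrier (P' i) = {\<zero>\<^bsub>P' i\<^esub>}"
proof -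
  note PD = projective_resolutionD[OF P]
  obtain \<sigma> where \<sigma>: "\<sigma> \<in> left_module_hom R (P n) (P n)"
      "\<And>x. x \<in> carrier (P (Suc n)) \<Longrightarrow> \<sigma> (d n x) = \<zero>\<^bsub>P n\<^esub>"
      "\<And>x. x \<in> carrier (P n) \<Longrightarrow> x \<ominus>\<^bsub>P n\<^esub> \<sigma> x \<in> d n ` carrier (P (Suc n))"
    using assms(3) unfolding splits_at_def by blast
  interpret Pn: left_module R "P n" by (rule PD(2))
  interpret X: left_module R X by (rule X)
  note closed = left_module_hom_closed[OF PD(3)] left_module_hom_closed[OF \<sigma>(1)]
  have idem: "\<sigma> (\<sigma> x) = \<sigma> x" if x: "x \<in> carrier (P n)" for x
  proof -
    have "\<sigma> x \<ominus>\<^bsub>P n\<^esub> \<sigma> (\<sigma> x) = \<sigma> (x \<ominus>\<^bsub>P n\<^esub> \<sigma> x)"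
      by (rule left_module_hom_diff[OF \<sigma>(1) PD(2) PD(2), symmetric]) (simp_all add: x closed)
    also have "\<dots> = \<zero>\<^bsub>P n\<^esub>" using \<sigma>(3)[OF x] \<sigma>(2) by auto
    finally show ?thesis
      by (rule Pn.minus_eq_zeroD[symmetric]) (simp_all add: x closed)
  qed
  \<comment> \<open>Only carriers shrink, so the truncated resolution stays in the type of P and its
    operations are those of P.\<close>
  define P' where "P' i = (if i < n then P i else if i = n then (P n)\<lparr>carrier := \<sigma> ` carrier (P n)\<rparr>
    else (P i)\<lparr>carrier := {\<zero>\<^bsub>P i\<^esub>}\<rparr>)" for i
  define d' where "d' i = (if i < n then d i else (\<lambda>_. \<zero>\<^bsub>P i\<^esub>))" for i
  have zero [simp]: "\<zero>\<^bsub>P' i\<^esub> = \<zero>\<^bsub>P i\<^esub>" for i by (simp add: P'_def)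
  have lt: "P' i = P i" "d' i = d i" if "i < n" for i using that by (simp_all add: P'_def d'_def)
  have gt: "carrier (P' i) = {\<zero>\<^bsub>P i\<^esub>}" if "i > n" for i using that by (simp add: P'_def)
  have at: "P' n = (P n)\<lparr>carrier := \<sigma> ` carrier (P n)\<rparr>" by (simp add: P'_def)
  have ge: "d' i = (\<lambda>_. \<zero>\<^bsub>P i\<^esub>)" if "i \<ge> n" for i using that by (simp add: d'_def)
  have sub: "left_submodule R (carrier (P' i)) (P i)" for i
    using left_submodule_image[OF \<sigma>(1) PD(2) PD(2)] left_submodule_zero[OF PD(2)]
      left_submodule_carrier[OF PD(2)]
    by (simp add: P'_def)
  have P'_eq: "P' i = (P i)\<lparr>carrier := carrier (P' i)\<rparr>" for i by (simp add: P'_def)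
  have P'_mod: "left_module R (P' i)" for i
    using left_module_submodule[OF PD(2) sub] P'_eq by metis
  \<comment> \<open>The preceding differential kills x - \<sigma> x, so restricting it to the
    complement does not change its image. For n = 0 the augmentation takes the place of this
    differential.\<close>
  have d\<sigma>: "d i (\<sigma> x) = d i x" if "Suc i = n" and x: "x \<in> carrier (P n)" for i x
  proof -
    interpret Pi: left_module R "P i" by (rule PD(2))
    have "d i x \<ominus>\<^bsub>P i\<^esub> d i (\<sigma> x) = d i (x \<ominus>\<^bsub>P n\<^esub> \<sigma> x)"
      using that closed by (intro left_module_hom_diff[symmetric, OF _ PD(2) PD(2)] PD(3)) (auto simp: PD(3))
    also have "\<dots> = \<zero>\<^bsub>P i\<^esub>" using \<sigma>(3)[OF x] PD(8) that by auto
    finally show ?thesis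
      by (rule Pi.minus_eq_zeroD[symmetric]) (use that closed in auto)
  qed
  have d_image: "d i ` carrier (P' (Suc i)) = d i ` carrier (P (Suc i))" if "i < n" for i
    using that d\<sigma>[of i] by (cases "Suc i = n") (auto simp: P'_def image_image)
  have e\<sigma>: "e (\<sigma> x) = e x" if "n = 0" and x: "x \<in> carrier (P n)" for x
  proof -
    have "e x \<ominus>\<^bsub>X\<^esub> e (\<sigma> x) = e (x \<ominus>\<^bsub>P n\<^esub> \<sigma> x)"
      using that closed PD(4) by (intro left_module_hom_diff[symmetric, OF _ PD(2) X]) auto
    also have "\<dots> = \<zero>\<^bsub>X\<^esub>" using \<sigma>(3)[OF x] PD(6) that by auto
    finally show ?thesis
      by (rule X.minus_eq_zeroD[symmetric]) (use that closed left_module_hom_closed[OF PD(4)] in auto)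
  qed
  \<comment> \<open>The complement meets the image of d n only in zero; this yields injectivity of
    the last map of the truncated resolution.\<close>
  have \<sigma>_zero: "\<sigma> x = \<zero>\<^bsub>P n\<^esub>" if "\<sigma> x \<in> d n ` carrier (P (Suc n))" "x \<in> carrier (P n)" for x
    using that idem[of x] \<sigma>(2) by auto
  have "projective_resolution R P' d' e X"
  proof (rule projective_resolutionI)
    fix i
    show "projective_module R (P' i)"
    proof (cases "i < n")
      case True
      then show ?thesis by (simp add: lt PD(1))
    next
      case False
      define p where "p = (if i = n then \<sigma> else (\<lambda>_. \<zero>\<^bsub>P i\<^esub>))"
      have "p \<in> left_module_hom R (P i) (P' i)"
      proof (cases "i = n")
        case True
        then show ?thesis using \<sigma>(1) by (simp add: p_def at left_module_hom_restrict_codomain)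
      next
        case False
        interpret P'i: left_module R "P' i" by (rule P'_mod)
        show ?thesis
          using False \<open>\<not> i < n\<close> P'i.smult_r_null P'i.r_zero[OF P'i.zero_closed]
          by (intro left_module_homI) (auto simp: p_def gt)
      qed
      moreover have "(\<lambda>x. x) \<in> left_module_hom R (P' i) (P i)"
        using sub[of i] left_module_hom_restrict_domain[OF left_module_hom_id, of "carrier (P' i)" "P i" R] P'_eq[of i]
        by (simp add: left_submodule_def)
      moreover have "p x = x" if "x \<in> carrier (P' i)" for x
        using that False idem by (auto simp: p_def at gt not_less P'_def split: if_splits)
      ultimately show ?thesis
        by (intro projective_module_retract[OF PD(1) P'_mod])
    qed
    show "d' i \<in> left_module_hom R (P' (Suc i)) (P' i)"
    proof (cases "i < n")
      case True
      then show ?thesis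
        using left_module_hom_restrict_domain[OF PD(3), of "carrier (P' (Suc i))" i] sub[of "Suc i"] P'_eq[of "Suc i"]
        by (simp add: lt left_submodule_def)
    next
      case False
      interpret P'i: left_module R "P' i" by (rule P'_mod)
      show ?thesis
        using False P'i.smult_r_null P'i.r_zero[OF P'i.zero_closed] P'i.zero_closed
        by (intro left_module_homI) (auto simp: ge)
    qed
    show "a_kernel (P' (Suc i)) (P' i) (d' i) = d' (Suc i) ` carrier (P' (Suc (Suc i)))"
    proof (cases "Suc i" n rule: linorder_cases)
      case less
      then have "a_kernel (P' (Suc i)) (P' i) (d' i) = d (Suc i) ` carrier (P (Suc (Suc i)))"
        using P by (simp add: lt projective_resolution_def)
      then show ?thesis using less by (simp add: d_image lt)
    next
      case equal
      have "a_kernel (P' (Suc i)) (P' i) (d' i) = {\<zero>\<^bsub>P n\<^esub>}"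
      proof (intro equalityI subsetI)
        fix y assume "y \<in> a_kernel (P' (Suc i)) (P' i) (d' i)"
        then obtain x where x: "y = \<sigma> x" "x \<in> carrier (P n)" "d i (\<sigma> x) = \<zero>\<^bsub>P i\<^esub>"
          using equal by (auto simp: a_kernel_def' at lt)
        then have "\<sigma> x \<in> d n ` carrier (P (Suc n))"
          using PD(9)[of "\<sigma> x" i] equal closed(2)[OF x(2)] by auto
        then show "y \<in> {\<zero>\<^bsub>P n\<^esub>}" using x \<sigma>_zero by simp
      next
        fix y assume "y \<in> {\<zero>\<^bsub>P n\<^esub>}"
        then show "y \<in> a_kernel (P' (Suc i)) (P' i) (d' i)"
          using sub[of n] left_module_hom_zero[OF PD(3) PD(2) PD(2), of i] equal
          by (auto simp: a_kernel_def' lt left_submodule_def)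
      qed
      then show ?thesis using equal by (simp add: gt ge)
    next
      case greater
      then show ?thesis by (auto simp: a_kernel_def' gt ge)
    qed
  next
    show "e \<in> left_module_hom R (P' 0) X"
      using left_module_hom_restrict_domain[OF PD(4), of "carrier (P' 0)"] sub[of 0] P'_eq[of 0]
      by (simp add: left_submodule_def)
    show "e ` carrier (P' 0) = carrier X"
      using e\<sigma> PD(5) by (cases "n = 0") (auto simp: P'_def image_image)
    show "a_kernel (P' 0) X e = d' 0 ` carrier (P' (Suc 0))"
    proof (cases "n = 0")
      case False
      then show ?thesis
        using P d_image[of 0] by (simp add: lt projective_resolution_def)
    next
      case True
      have "a_kernel (P' 0) X e = {\<zero>\<^bsub>P n\<^esub>}"
      proof (intro equalityI subsetI)
        fix y assume "y \<in> a_kernel (P' 0) X e"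
        then obtain x where x: "y = \<sigma> x" "x \<in> carrier (P n)" "e (\<sigma> x) = \<zero>\<^bsub>X\<^esub>"
          using True at by (auto simp: a_kernel_def')
        then have "\<sigma> x \<in> d n ` carrier (P (Suc n))"
          using PD(7)[of "\<sigma> x"] True closed(2)[OF x(2)] by auto
        then show "y \<in> {\<zero>\<^bsub>P n\<^esub>}" using x \<sigma>_zero by simp
      next
        fix y assume "y \<in> {\<zero>\<^bsub>P n\<^esub>}"
        then show "y \<in> a_kernel (P' 0) X e"
          using sub[of 0] left_module_hom_zero[OF PD(4) PD(2) X] True
          by (auto simp: a_kernel_def' left_submodule_def)
      qed
      then show ?thesis using True by (simp add: gt ge)
    qed
  qed
  then show thesis by (rule that) (simp add: gt)
qed

text \<open>The given resolution may have elements of any type. A splitting in it gives a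
  truncation, the truncation forces a splitting in some resolution Q over \<open>univ\<close>, and
  truncating Q produces the witness that \<open>proj_dim\<close> asks for.\<close>

lemma proj_dim_eq:
  fixes X :: "('r, 'a) module" and P :: "nat \<Rightarrow> ('r, 'b) module"
  assumes P: "projective_resolution R P d e X" and X: "left_module R X"
  shows "proj_dim R X = Inf {enat n | n. splits_at R P d n}"
proof -
  have "(\<exists>(Q :: nat \<Rightarrow> ('r, ('r, 'a) univ) module) d e.
      projective_resolution R Q d e X \<and> (\<forall>i>n. carrier (Q i) = {\<zero>\<^bsub>Q i\<^esub>})) \<longleftrightarrow> splits_at R P d n"
    (is "?lhs \<longleftrightarrow> _") for n
  proof
    assume ?lhs
    then obtain Q :: "nat \<Rightarrow> ('r, ('r, 'a) univ) module" and dQ eQ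
      where Q: "projective_resolution R Q dQ eQ X" "\<forall>i>n. carrier (Q i) = {\<zero>\<^bsub>Q i\<^esub>}"
      by (elim exE conjE)
    show "splits_at R P d n"
      by (rule finite_resolution_splits_at[OF Q(1) P X]) (simp add: Q(2))
  next
    assume n: "splits_at R P d n"
    obtain P' :: "nat \<Rightarrow> ('r, 'b) module" and d' e' where P': "projective_resolution R P' d' e' X"
      "\<forall>i>n. carrier (P' i) = {\<zero>\<^bsub>P' i\<^esub>}"
      by (rule splits_at_imp_finite_resolution[OF P X n])
    obtain Q :: "nat \<Rightarrow> ('r, ('r, 'a) univ) module" and dQ eQ where Q: "projective_resolution R Q dQ eQ X"
      by (rule projective_resolution_exists[OF X])
    have n': "splits_at R Q dQ n"
      by (rule finite_resolution_splits_at[OF P'(1) Q X]) (simp add: P'(2))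
    obtain Q' :: "nat \<Rightarrow> ('r, ('r, 'a) univ) module" and d'' e'' where Q': "projective_resolution R Q' d'' e'' X"
      "\<forall>i>n. carrier (Q' i) = {\<zero>\<^bsub>Q' i\<^esub>}"
      by (rule splits_at_imp_finite_resolution[OF Q X n'])
    then show ?lhs
      by (intro exI conjI)
  qed
  then show ?thesis by (simp add: proj_dim_def)
qed

section \<open>Base change along a split surjection\<close>

text \<open>The product I X. Only sums are generated; for I = J, negatives are absorbed by the
  module factor of each term. The set I is arbitrary so that powers of J fit as well.\<close>

inductive_set ideal_smult :: "'s set \<Rightarrow> ('s, 'a) module \<Rightarrow> 'a set"
  for I and X where
    zero: "\<zero>\<^bsub>X\<^esub> \<in> ideal_smult I X"
  | smult: "\<lbrakk>a \<in> I; x \<in> carrier X\<rbrakk> \<Longrightarrow> a \<odot>\<^bsub>X\<^esub> x \<in> ideal_smult I X"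
  | add: "\<lbrakk>x \<in> ideal_smult I X; y \<in> ideal_smult I X\<rbrakk> \<Longrightarrow> x \<oplus>\<^bsub>X\<^esub> y \<in> ideal_smult I X"

locale split_extension = S: ring S + R: ring R
  for S :: "('s, 'k) ring_scheme" and R :: "('r, 'l) ring_scheme" +
  fixes \<iota> :: "'r \<Rightarrow> 's" and \<pi> :: "'s \<Rightarrow> 'r"
  assumes iota: "\<iota> \<in> ring_hom R S" and pi: "\<pi> \<in> ring_hom S R"
    and pi_iota: "r \<in> carrier R \<Longrightarrow> \<pi> (\<iota> r) = r"
begin

section \<open>The tensor product with R as a group of cosets\<close>

abbreviation "N \<equiv> right_module_via R \<pi>"
abbreviation "J \<equiv> a_kernel S R \<pi>"
abbreviation "pairs X \<equiv> free_Abelian_group (carrier R \<times> carrier X)"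
abbreviation "rel X \<equiv> tensor_rel S N X"
abbreviation "coset X c \<equiv> rel X #>\<^bsub>pairs X\<^esub> c"
abbreviation "lift_pairs u f \<equiv> frag_extend (\<lambda>(n, x). frag_of (u n, f x))"

lemmas iota_simps = ring_hom_closed[OF iota] ring_hom_add[OF iota] ring_hom_mult[OF iota] ring_hom_one[OF iota]
  ring_hom_zero[OF iota R.ring_axioms S.ring_axioms]
lemmas pi_simps = ring_hom_closed[OF pi] ring_hom_add[OF pi] ring_hom_mult[OF pi] ring_hom_one[OF pi]
  ring_hom_zero[OF pi S.ring_axioms R.ring_axioms] pi_iota

lemma N_simps [simp]: "carrier N = carrier R" "add N = add R" "smult N s r = r \<otimes>\<^bsub>R\<^esub> \<pi> s"
  by (simp_all add: right_module_via_def)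

lemma J_iff: "a \<in> J \<longleftrightarrow> a \<in> carrier S \<and> \<pi> a = \<zero>\<^bsub>R\<^esub>"
  by (simp add: a_kernel_def')

text \<open>The three families of relations in \<open>tensor_rel\<close>, with the right action of S
  on R unfolded, as rules suited to introduction and case analysis.\<close>

inductive_set tensor_gens :: "('s, 'a) module \<Rightarrow> ('r \<times> 'a \<Rightarrow>\<^sub>0 int) set"
  for X where
    left: "\<lbrakk>n \<in> carrier R; n' \<in> carrier R; x \<in> carrier X\<rbrakk> \<Longrightarrow>
      frag_of (n \<oplus>\<^bsub>R\<^esub> n', x) - frag_of (n, x) - frag_of (n', x) \<in> tensor_gens X"
  | right: "\<lbrakk>n \<in> carrier R; x \<in> carrier X; x' \<in> carrier X\<rbrakk> \<Longrightarrow>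
      frag_of (n, x \<oplus>\<^bsub>X\<^esub> x') - frag_of (n, x) - frag_of (n, x') \<in> tensor_gens X"
  | balanced: "\<lbrakk>s \<in> carrier S; n \<in> carrier R; x \<in> carrier X\<rbrakk> \<Longrightarrow>
      frag_of (n \<otimes>\<^bsub>R\<^esub> \<pi> s, x) - frag_of (n, s \<odot>\<^bsub>X\<^esub> x) \<in> tensor_gens X"

lemma rel_eq: "rel X = generate (pairs X) (tensor_gens X)"
proof -
  have "tensor_gens X =
    {frag_of (n \<oplus>\<^bsub>R\<^esub> n', x) - frag_of (n, x) - frag_of (n', x) | n n' x.
        n \<in> carrier R \<and> n' \<in> carrier R \<and> x \<in> carrier X} \<union>
    {frag_of (n, x \<oplus>\<^bsub>X\<^esub> x') - frag_of (n, x) - frag_of (n, x') | n x x'.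
        n \<in> carrier R \<and> x \<in> carrier X \<and> x' \<in> carrier X} \<union>
    {frag_of (n \<otimes>\<^bsub>R\<^esub> \<pi> s, x) - frag_of (n, s \<odot>\<^bsub>X\<^esub> x) | s n x.
        s \<in> carrier S \<and> n \<in> carrier R \<and> x \<in> carrier X}" (is "_ = ?A \<union> ?B \<union> ?C")
  proof (intro equalityI subsetI)
    fix c assume "c \<in> tensor_gens X"
    then show "c \<in> ?A \<union> ?B \<union> ?C"
      by cases blast+
  next
    fix c assume "c \<in> ?A \<union> ?B \<union> ?C"
    then show "c \<in> tensor_gens X"
      by (elim UnE CollectE exE conjE) (simp_all add: tensor_gens.intros)
  qed
  then show ?thesis by (simp add: tensor_rel_def)
qed

lemma free_Abelian_group_diff_closed: "\<lbrakk>a \<in> carrier (free_Abelian_group A); b \<in> carrier (free_Abelian_group A)\<rbrakk> \<Longrightarrow>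
    a - b \<in> carrier (free_Abelian_group A)"
  using keys_diff[of a b] by auto

lemma frag_of_carrier: "\<lbrakk>n \<in> carrier R; x \<in> carrier X\<rbrakk> \<Longrightarrow> frag_of (n, x) \<in> carrier (pairs X)"
  by simp

lemma tensor_gens_subset:
  assumes "left_module S X"
  shows "tensor_gens X \<subseteq> carrier (pairs X)"
proof -
  interpret X: left_module S X by fact
  show ?thesis
  proof
    fix c assume "c \<in> tensor_gens X"
    then show "c \<in> carrier (pairs X)"
      by cases (simp only:, intro free_Abelian_group_diff_closed frag_of_carrier; simp add: pi_simps X.smult_closed)+
  qed
qed

lemma subgroup_rel:
  assumes "left_module S X"
  shows "subgroup (rel X) (pairs X)"
  unfolding rel_eq by (rule group.generate_is_subgroup[OF group_free_Abelian_group tensor_gens_subset[OF assms]])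

lemma rel_closed:
  assumes X: "left_module S X"
  shows "0 \<in> rel X" "\<lbrakk>a \<in> rel X; b \<in> rel X\<rbrakk> \<Longrightarrow> a + b \<in> rel X" "a \<in> rel X \<Longrightarrow> - a \<in> rel X"
    "\<lbrakk>a \<in> rel X; b \<in> rel X\<rbrakk> \<Longrightarrow> a - b \<in> rel X"
proof -
  interpret subgroup "rel X" "pairs X" by (rule subgroup_rel[OF X])
  show zero: "0 \<in> rel X" using one_closed by simp
  show add: "a + b \<in> rel X" if "a \<in> rel X" "b \<in> rel X" for a b
    using m_closed[OF that] by simp
  show minus: "- a \<in> rel X" if "a \<in> rel X" for a
    using m_inv_closed[OF that] mem_carrier[OF that] by simp
  show "a - b \<in> rel X" if "a \<in> rel X" "b \<in> rel X" for a b
    using add[OF that(1) minus[OF that(2)]] by simp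
qed

lemma tensor_gens_rel: "c \<in> tensor_gens X \<Longrightarrow> c \<in> rel X"
  unfolding rel_eq by (rule generate.incl)

lemma coset_iff: "c' \<in> coset X c \<longleftrightarrow> (\<exists>h\<in>rel X. c' = h + c)"
  by (simp add: r_coset_def)

lemma coset_eq_iff:
  assumes X: "left_module S X"
  shows "coset X c = coset X c' \<longleftrightarrow> c - c' \<in> rel X"
proof
  assume "coset X c = coset X c'"
  moreover have "c \<in> coset X c"
    unfolding coset_iff by (rule bexI[OF _ rel_closed(1)[OF X]]) simp
  ultimately show "c - c' \<in> rel X"
    by (auto simp: coset_iff)
next
  assume *: "c - c' \<in> rel X"
  have "h + c \<in> coset X c'" if "h \<in> rel X" for h
    unfolding coset_iff by (rule bexI[OF _ rel_closed(2)[OF X that *]]) simp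
  moreover have "h + c' \<in> coset X c" if "h \<in> rel X" for h
    unfolding coset_iff by (rule bexI[OF _ rel_closed(4)[OF X that *]]) simp
  ultimately show "coset X c = coset X c'"
    by (auto simp: coset_iff[of _ _ c] coset_iff[of _ _ c'])
qed

lemma tensor_group_simps:
  "carrier (tensor_group S N X) = coset X ` carrier (pairs X)"
  "\<one>\<^bsub>tensor_group S N X\<^esub> = rel X"
  by (simp_all add: tensor_group_def carrier_FactGroup del: carrier_free_Abelian_group_iff)

lemma tensor_group_mult:
  assumes X: "left_module S X"
  shows "coset X c \<otimes>\<^bsub>tensor_group S N X\<^esub> coset X c' = coset X (c + c')"
proof -
  have "coset X c <#>\<^bsub>pairs X\<^esub> coset X c' = coset X (c + c')"
  proof (intro equalityI subsetI)
    fix y assume "y \<in> coset X c <#>\<^bsub>pairs X\<^esub> coset X c'"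
    then obtain h h' where h: "h \<in> rel X" "h' \<in> rel X" "y = (h + c) + (h' + c')"
      by (auto simp: set_mult_def r_coset_def)
    show "y \<in> coset X (c + c')"
      unfolding coset_iff by (rule bexI[OF _ rel_closed(2)[OF X h(1,2)]]) (simp add: h(3))
  next
    fix y assume "y \<in> coset X (c + c')"
    then obtain h where h: "h \<in> rel X" "y = (h + c) + (0 + c')"
      by (auto simp: coset_iff add.assoc)
    have "h + c \<in> coset X c" "0 + c' \<in> coset X c'"
      using h(1) rel_closed(1)[OF X] by (auto simp: coset_iff)
    then show "y \<in> coset X c <#>\<^bsub>pairs X\<^esub> coset X c'"
      unfolding set_mult_def using h(2) by auto
  qed
  then show ?thesis
    by (simp add: tensor_group_def)
qed

lemma comm_group_tensor_group:
  assumes X: "left_module S X"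
  shows "comm_group (tensor_group S N X)"
  unfolding tensor_group_def N_simps
  by (rule comm_group.abelian_FactGroup[OF abelian_free_Abelian_group subgroup_rel[OF X]])

text \<open>Right R-linearity of u contains compatibility with the right action of S through \<pi>,
  so each generating relation is sent to a generating relation. The instances used are u the
  identity and u a left multiplication.\<close>

lemma lift_pairs_rel:
  assumes X: "left_module S X" and Y: "left_module S Y" and f: "f \<in> left_module_hom S X Y"
    and u: "\<And>n. n \<in> carrier R \<Longrightarrow> u n \<in> carrier R"
    and u_add: "\<And>n n'. \<lbrakk>n \<in> carrier R; n' \<in> carrier R\<rbrakk> \<Longrightarrow> u (n \<oplus>\<^bsub>R\<^esub> n') = u n \<oplus>\<^bsub>R\<^esub> u n'"
    and u_mult: "\<And>n r. \<lbrakk>n \<in> carrier R; r \<in> carrier R\<rbrakk> \<Longrightarrow> u (n \<otimes>\<^bsub>R\<^esub> r) = u n \<otimes>\<^bsub>R\<^esub> r"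
    and c: "c \<in> rel X"
  shows "lift_pairs u f c \<in> rel Y"
proof -
  have gens: "lift_pairs u f c \<in> tensor_gens Y" if "c \<in> tensor_gens X" for c
    using that
  proof cases
    case (left n n' x)
    then show ?thesis
      using tensor_gens.left[of "u n" "u n'" "f x" Y]
      by (simp add: frag_extend_diff u u_add left_module_hom_closed[OF f])
  next
    case (right n x x')
    then show ?thesis
      using tensor_gens.right[of "u n" "f x" Y "f x'"]
      by (simp add: frag_extend_diff u left_module_hom_add[OF f] left_module_hom_closed[OF f])
  next
    case (balanced s n x)
    then show ?thesis
      using tensor_gens.balanced[of s "u n" "f x" Y]
      by (simp add: frag_extend_diff u u_mult pi_simps left_module_hom_smult[OF f] left_module_hom_closed[OF f])
  qed
  from c show ?thesis
    unfolding rel_eq[of X]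
  proof (induction rule: generate.induct)
    case one
    then show ?case using rel_closed(1)[OF Y] by simp
  next
    case (incl h)
    then show ?case by (intro tensor_gens_rel gens)
  next
    case (inv h)
    then have "inv\<^bsub>pairs X\<^esub> h = - h"
      using subsetD[OF tensor_gens_subset[OF X], of h] by (intro inv_free_Abelian_group) simp
    then show ?case
      using rel_closed(3)[OF Y tensor_gens_rel[OF gens[OF inv]]] by (simp add: frag_extend_minus)
  next
    case (eng h1 h2)
    then show ?case by (simp add: frag_extend_add rel_closed(2)[OF Y])
  qed
qed

text \<open>Well-definedness of \<open>tensor_map\<close>: all representatives of a coset give the
  same value, so \<open>the_elem\<close> is applied to a singleton.\<close>

lemma tensor_map_coset:
  assumes X: "left_module S X" and Y: "left_module S Y" and f: "f \<in> left_module_hom S X Y"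
    and u: "\<And>n. n \<in> carrier R \<Longrightarrow> u n \<in> carrier R"
    and u_add: "\<And>n n'. \<lbrakk>n \<in> carrier R; n' \<in> carrier R\<rbrakk> \<Longrightarrow> u (n \<oplus>\<^bsub>R\<^esub> n') = u n \<oplus>\<^bsub>R\<^esub> u n'"
    and u_mult: "\<And>n r. \<lbrakk>n \<in> carrier R; r \<in> carrier R\<rbrakk> \<Longrightarrow> u (n \<otimes>\<^bsub>R\<^esub> r) = u n \<otimes>\<^bsub>R\<^esub> r"
  shows "tensor_map S N Y u f (coset X c) = coset Y (lift_pairs u f c)"
proof -
  have "coset Y (lift_pairs u f c') = coset Y (lift_pairs u f c)" if "c' \<in> coset X c" for c'
  proof -
    from that obtain h where h: "h \<in> rel X" "c' = h + c" by (auto simp: coset_iff)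
    then show ?thesis
      by (simp add: coset_eq_iff[OF Y] frag_extend_add lift_pairs_rel[OF assms])
  qed
  moreover have "c \<in> coset X c"
    unfolding coset_iff by (rule bexI[OF _ rel_closed(1)[OF X]]) simp
  ultimately have "(\<lambda>c. coset Y (lift_pairs u f c)) ` coset X c = {coset Y (lift_pairs u f c)}"
    by blast
  then show ?thesis
    by (simp add: tensor_map_def)
qed

subsection \<open>The unit \<open>x \<mapsto> 1 \<otimes> x\<close>\<close>

definition unit :: "('s, 'a) module \<Rightarrow> 'a \<Rightarrow> ('r \<times> 'a \<Rightarrow>\<^sub>0 int) set"
  where "unit X x = coset X (frag_of (\<one>\<^bsub>R\<^esub>, x))"

lemma unit_tensor_add:
  assumes X: "left_module S X" and "x \<in> carrier X" "y \<in> carrier X"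
  shows "unit X (x \<oplus>\<^bsub>X\<^esub> y) = unit X x \<otimes>\<^bsub>tensor_group S N X\<^esub> unit X y"
proof -
  have "frag_of (\<one>\<^bsub>R\<^esub>, x \<oplus>\<^bsub>X\<^esub> y) - frag_of (\<one>\<^bsub>R\<^esub>, x) - frag_of (\<one>\<^bsub>R\<^esub>, y) \<in> rel X"
    using assms by (intro tensor_gens_rel tensor_gens.right) simp_all
  then show ?thesis
    by (simp add: unit_def tensor_group_mult[OF X] coset_eq_iff[OF X] diff_diff_eq)
qed

text \<open>Balance 1 \<otimes> \<iota> r x, using \<pi> (\<iota> r) = r.\<close>

lemma pure_tensor_eq_unit:
  assumes X: "left_module S X" and "r \<in> carrier R" "x \<in> carrier X"
  shows "coset X (frag_of (r, x)) = unit X (\<iota> r \<odot>\<^bsub>X\<^esub> x)"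
proof -
  have "frag_of (\<one>\<^bsub>R\<^esub> \<otimes>\<^bsub>R\<^esub> \<pi> (\<iota> r), x) - frag_of (\<one>\<^bsub>R\<^esub>, \<iota> r \<odot>\<^bsub>X\<^esub> x) \<in> rel X"
    using assms by (intro tensor_gens_rel tensor_gens.balanced) (simp_all add: iota_simps)
  then show ?thesis
    using assms by (simp add: unit_def coset_eq_iff[OF X] pi_iota)
qed

text \<open>Pure tensors have the form 1 \<otimes> x, and this form is stable under differences.
  Computations in R \<otimes> X can therefore be carried out on representatives in X.\<close>

lemma carrier_tensor_group:
  assumes X: "left_module S X"
  shows "carrier (tensor_group S N X) = unit X ` carrier X"
proof (intro equalityI subsetI)
  fix C assume "C \<in> unit X ` carrier X"
  then show "C \<in> carrier (tensor_group S N X)"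
    by (auto simp: tensor_group_simps unit_def)
next
  interpret X: left_module S X by fact
  fix C assume "C \<in> carrier (tensor_group S N X)"
  then obtain c where c: "C = coset X c" "Poly_Mapping.keys c \<subseteq> carrier R \<times> carrier X"
    by (auto simp: tensor_group_simps)
  have "coset X c \<in> unit X ` carrier X"
  proof (rule free_Abelian_group_induct[where P = "\<lambda>c. coset X c \<in> unit X ` carrier X", OF c(2)])
    have "coset X 0 = coset X (frag_of (\<zero>\<^bsub>R\<^esub>, \<zero>\<^bsub>X\<^esub>))"
    proof -
      have "frag_of (\<zero>\<^bsub>R\<^esub> \<oplus>\<^bsub>R\<^esub> \<zero>\<^bsub>R\<^esub>, \<zero>\<^bsub>X\<^esub>) - frag_of (\<zero>\<^bsub>R\<^esub>, \<zero>\<^bsub>X\<^esub>) - frag_of (\<zero>\<^bsub>R\<^esub>, \<zero>\<^bsub>X\<^esub>) \<in> rel X"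
        by (intro tensor_gens_rel tensor_gens.left) simp_all
      then have "0 - frag_of (\<zero>\<^bsub>R\<^esub>, \<zero>\<^bsub>X\<^esub>) \<in> rel X" by simp
      then show ?thesis unfolding coset_eq_iff[OF X] .
    qed
    also have "\<dots> = unit X (\<iota> \<zero>\<^bsub>R\<^esub> \<odot>\<^bsub>X\<^esub> \<zero>\<^bsub>X\<^esub>)"
      by (rule pure_tensor_eq_unit[OF X]) auto
    finally show "coset X 0 \<in> unit X ` carrier X" by (simp add: iota_simps X.smult_closed)
  next
    fix a b
    assume "coset X a \<in> unit X ` carrier X" "coset X b \<in> unit X ` carrier X"
    then obtain x y where xy: "x \<in> carrier X" "y \<in> carrier X" "coset X a = unit X x" "coset X b = unit X y"
      by auto
    \<comment> \<open>The induction rule for free abelian groups asks for differences; writing x =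
      (x - y) + y reduces this case to additivity of \<open>unit\<close>.\<close>
    have "unit X x = unit X (x \<ominus>\<^bsub>X\<^esub> y) \<otimes>\<^bsub>tensor_group S N X\<^esub> unit X y"
      using xy by (subst unit_tensor_add[OF X, symmetric]) (simp_all add: a_minus_def X.a_assoc X.l_neg)
    then have "coset X a = unit X (x \<ominus>\<^bsub>X\<^esub> y) \<otimes>\<^bsub>tensor_group S N X\<^esub> coset X b"
      by (simp add: xy)
    then have "coset X a = coset X (frag_of (\<one>\<^bsub>R\<^esub>, x \<ominus>\<^bsub>X\<^esub> y) + b)"
      unfolding unit_def tensor_group_mult[OF X] .
    then have "coset X (a - b) = unit X (x \<ominus>\<^bsub>X\<^esub> y)"
      by (simp add: unit_def coset_eq_iff[OF X] algebra_simps)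
    then show "coset X (a - b) \<in> unit X ` carrier X" using xy by simp
  next
    fix p
    assume "p \<in> carrier R \<times> carrier X"
    then show "coset X (frag_of p) \<in> unit X ` carrier X"
      using pure_tensor_eq_unit[OF X, of "fst p" "snd p"]
      by (cases p) (auto simp: iota_simps X.smult_closed)
  qed
  then show "C \<in> unit X ` carrier X" by (simp add: c(1))
qed

lemma base_change_simps:
  "carrier (base_change S R \<pi> X) = carrier (tensor_group S N X)"
  "add (base_change S R \<pi> X) = mult (tensor_group S N X)"
  "\<zero>\<^bsub>base_change S R \<pi> X\<^esub> = \<one>\<^bsub>tensor_group S N X\<^esub>"
  "r \<odot>\<^bsub>base_change S R \<pi> X\<^esub> C = tensor_map S N X (mult R r) (\<lambda>x. x) C"
  by (simp_all add: base_change_def tensor_module_def)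

lemma smult_unit:
  assumes X: "left_module S X" and r: "r \<in> carrier R" and x: "x \<in> carrier X"
  shows "r \<odot>\<^bsub>base_change S R \<pi> X\<^esub> unit X x = unit X (\<iota> r \<odot>\<^bsub>X\<^esub> x)"
proof -
  have "r \<odot>\<^bsub>base_change S R \<pi> X\<^esub> unit X x = coset X (frag_of (r \<otimes>\<^bsub>R\<^esub> \<one>\<^bsub>R\<^esub>, x))"
    unfolding base_change_simps unit_def using r
    by (subst tensor_map_coset[OF X X left_module_hom_id]) (simp_all add: R.r_distr R.m_assoc)
  then show ?thesis
    using r x by (simp add: pure_tensor_eq_unit[OF X])
qed

lemma unit_add: "\<lbrakk>left_module S X; x \<in> carrier X; y \<in> carrier X\<rbrakk> \<Longrightarrow>
    unit X (x \<oplus>\<^bsub>X\<^esub> y) = unit X x \<oplus>\<^bsub>base_change S R \<pi> X\<^esub> unit X y"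
  by (simp add: unit_tensor_add base_change_simps)

lemma carrier_base_change: "left_module S X \<Longrightarrow> carrier (base_change S R \<pi> X) = unit X ` carrier X"
  by (simp add: carrier_tensor_group base_change_simps)

lemma unit_zero:
  assumes X: "left_module S X"
  shows "unit X \<zero>\<^bsub>X\<^esub> = \<zero>\<^bsub>base_change S R \<pi> X\<^esub>"
proof -
  interpret X: left_module S X by fact
  interpret T: comm_group "tensor_group S N X" by (rule comm_group_tensor_group[OF X])
  have "unit X \<zero>\<^bsub>X\<^esub> \<in> carrier (tensor_group S N X)"
    by (simp add: carrier_tensor_group[OF X])
  then show ?thesis
    using unit_tensor_add[OF X X.zero_closed X.zero_closed] by (simp add: base_change_simps)
qed

text \<open>As \<open>unit\<close> is onto and r acts on 1 \<otimes> x through \<iota> r, each axiom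
  is inherited from X.\<close>

lemma left_module_base_change:
  assumes X: "left_module S X"
  shows "left_module R (base_change S R \<pi> X)"
proof -
  interpret X: left_module S X by fact
  show ?thesis
    by (rule left_moduleI[OF R.ring_axioms])
      (auto simp: carrier_base_change[OF X] smult_unit[OF X] iota_simps X.smult_closed X.smult_l_distr X.smult_r_distr
        X.smult_assoc X.smult_one X.smult_l_null X.a_ac
        simp flip: unit_add[OF X] unit_zero[OF X])
qed

lemma unit_closed: "\<lbrakk>left_module S X; x \<in> carrier X\<rbrakk> \<Longrightarrow> unit X x \<in> carrier (base_change S R \<pi> X)"
  by (simp add: carrier_base_change)

lemma unit_smult:
  assumes X: "left_module S X" and s: "s \<in> carrier S" and x: "x \<in> carrier X"
  shows "unit X (s \<odot>\<^bsub>X\<^esub> x) = \<pi> s \<odot>\<^bsub>base_change S R \<pi> X\<^esub> unit X x"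
proof -
  have "frag_of (\<one>\<^bsub>R\<^esub> \<otimes>\<^bsub>R\<^esub> \<pi> s, x) - frag_of (\<one>\<^bsub>R\<^esub>, s \<odot>\<^bsub>X\<^esub> x) \<in> rel X"
    using assms by (intro tensor_gens_rel tensor_gens.balanced) simp_all
  then have "coset X (frag_of (\<pi> s, x)) = unit X (s \<odot>\<^bsub>X\<^esub> x)"
    using s by (simp add: unit_def coset_eq_iff[OF X] pi_simps)
  then show ?thesis
    using assms by (simp add: smult_unit[OF X] pure_tensor_eq_unit[OF X] pi_simps)
qed

lemma unit_uminus:
  assumes X: "left_module S X" and x: "x \<in> carrier X"
  shows "unit X (\<ominus>\<^bsub>X\<^esub> x) = \<ominus>\<^bsub>base_change S R \<pi> X\<^esub> unit X x"
proof -
  interpret X: left_module S X by fact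
  interpret B: left_module R "base_change S R \<pi> X" by (rule left_module_base_change[OF X])
  have "unit X (\<ominus>\<^bsub>X\<^esub> x) \<oplus>\<^bsub>base_change S R \<pi> X\<^esub> unit X x = \<zero>\<^bsub>base_change S R \<pi> X\<^esub>"
    using x by (simp add: X.l_neg unit_zero[OF X] flip: unit_add[OF X])
  then show ?thesis
    using x by (intro B.minus_equality[symmetric]) (simp_all add: unit_closed[OF X])
qed

lemma unit_diff:
  assumes X: "left_module S X" and "x \<in> carrier X" "y \<in> carrier X"
  shows "unit X (x \<ominus>\<^bsub>X\<^esub> y) = unit X x \<ominus>\<^bsub>base_change S R \<pi> X\<^esub> unit X y"
proof -
  interpret X: left_module S X by fact
  show ?thesis
    using assms by (simp add: a_minus_def unit_add unit_uminus)
qed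

section \<open>The kernel of the unit: R \<otimes> X as X / J X\<close>

lemma ideal_smult_J_carrier:
  assumes X: "left_module S X" and "x \<in> ideal_smult J X"
  shows "x \<in> carrier X"
proof -
  interpret X: left_module S X by fact
  show ?thesis
    using assms(2) by induction (auto simp: J_iff X.smult_closed)
qed

lemma ideal_smult_J_uminus:
  assumes X: "left_module S X" and "x \<in> ideal_smult J X"
  shows "\<ominus>\<^bsub>X\<^esub> x \<in> ideal_smult J X"
proof -
  interpret X: left_module S X by fact
  show ?thesis
    using assms(2)
  proof induction
    case zero
    then show ?case unfolding X.uminus_zero by (rule ideal_smult.zero)
  next
    case (smult a x)
    then show ?case
      using ideal_smult.smult[of a J "\<ominus>\<^bsub>X\<^esub> x" X] by (simp add: J_iff X.smult_r_minus)
  next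
    case (add x y)
    then show ?case
      by (simp add: X.minus_add ideal_smult_J_carrier[OF X] ideal_smult.add)
  qed
qed

text \<open>For the direction from left to right, (r, x) \<mapsto> \<iota> r x is extended to h on
  the free abelian group on pairs. It need not respect the balancing relations, but it sends every
  relation into J X; applied to (1, x) - (1, 0), which is then a relation, it returns x.\<close>

lemma unit_eq_zero_iff:
  assumes X: "left_module S X" and x: "x \<in> carrier X"
  shows "unit X x = \<zero>\<^bsub>base_change S R \<pi> X\<^esub> \<longleftrightarrow> x \<in> ideal_smult J X"
proof
  interpret X: left_module S X by fact
  interpret B: left_module R "base_change S R \<pi> X" by (rule left_module_base_change[OF X])
  assume "x \<in> ideal_smult J X"
  then show "unit X x = \<zero>\<^bsub>base_change S R \<pi> X\<^esub>"
    by induction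
      (auto simp: unit_zero[OF X] J_iff unit_smult[OF X] B.smult_l_null unit_closed[OF X] unit_add[OF X]
        ideal_smult_J_carrier[OF X])
next
  interpret X: left_module S X by fact
  assume "unit X x = \<zero>\<^bsub>base_change S R \<pi> X\<^esub>"
  then have "coset X (frag_of (\<one>\<^bsub>R\<^esub>, x)) = coset X (frag_of (\<one>\<^bsub>R\<^esub>, \<zero>\<^bsub>X\<^esub>))"
    unfolding unit_zero[OF X, symmetric] by (simp add: unit_def)
  then have rel: "frag_of (\<one>\<^bsub>R\<^esub>, x) - frag_of (\<one>\<^bsub>R\<^esub>, \<zero>\<^bsub>X\<^esub>) \<in> rel X"
    by (simp add: coset_eq_iff[OF X])
  have "(\<lambda>(r, x). \<iota> r \<odot>\<^bsub>X\<^esub> x) ` (carrier R \<times> carrier X) \<subseteq> carrier (add_monoid X)"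
    by (auto simp: iota_simps X.smult_closed)
  then obtain h where h: "h \<in> hom (pairs X) (add_monoid X)"
    "\<And>p. p \<in> carrier R \<times> carrier X \<Longrightarrow> h (frag_of p) = (\<lambda>(r, x). \<iota> r \<odot>\<^bsub>X\<^esub> x) p"
    using comm_group.free_Abelian_group_universal[OF X.a_comm_group] by metis
  have h_of: "h (frag_of (r, y)) = \<iota> r \<odot>\<^bsub>X\<^esub> y" if "r \<in> carrier R" "y \<in> carrier X" for r y
    using h(2)[of "(r, y)"] that by simp
  interpret h: group_hom "pairs X" "add_monoid X" h
    using h(1) X.a_group by (simp add: group_hom_def group_hom_axioms_def)
  have h_add: "h (a + b) = h a \<oplus>\<^bsub>X\<^esub> h b" if "a \<in> carrier (pairs X)" "b \<in> carrier (pairs X)" for a b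
    using h.hom_mult[OF that] by simp
  have h_minus: "h (- a) = \<ominus>\<^bsub>X\<^esub> h a" if "a \<in> carrier (pairs X)" for a
    using h.hom_inv[OF that] that by (simp add: a_inv_def)
  have h_closed: "h a \<in> carrier X" if "a \<in> carrier (pairs X)" for a
    using h.hom_closed[OF that] by simp
  have h_diff: "h (a - b) = h a \<ominus>\<^bsub>X\<^esub> h b" if "a \<in> carrier (pairs X)" "b \<in> carrier (pairs X)" for a b
    using that h_add[of a "- b"] h_minus[of b] by (simp add: a_minus_def)
  have gens: "h c \<in> ideal_smult J X" if c: "c \<in> tensor_gens X" for c
  proof -
    note h_simps = h_diff h_of free_Abelian_group_diff_closed frag_of_carrier iota_simps pi_simps X.smult_closed
    from c show ?thesis
    proof cases
      case (left n n' y)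
      then have "h c = (\<iota> n \<odot>\<^bsub>X\<^esub> y \<oplus>\<^bsub>X\<^esub> \<iota> n' \<odot>\<^bsub>X\<^esub> y) \<ominus>\<^bsub>X\<^esub> \<iota> n \<odot>\<^bsub>X\<^esub> y \<ominus>\<^bsub>X\<^esub> \<iota> n' \<odot>\<^bsub>X\<^esub> y"
        by (simp add: h_simps X.smult_l_distr del: carrier_free_Abelian_group_iff)
      also have "\<dots> = \<zero>\<^bsub>X\<^esub>"
        using left by (simp add: a_minus_def X.a_ac iota_simps X.smult_closed X.r_neg X.r_neg1 X.r_neg2)
      finally show ?thesis by (simp add: ideal_smult.zero)
    next
      case (right n y y')
      then have "h c = (\<iota> n \<odot>\<^bsub>X\<^esub> y \<oplus>\<^bsub>X\<^esub> \<iota> n \<odot>\<^bsub>X\<^esub> y') \<ominus>\<^bsub>X\<^esub> \<iota> n \<odot>\<^bsub>X\<^esub> y \<ominus>\<^bsub>X\<^esub> \<iota> n \<odot>\<^bsub>X\<^esub> y'"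
        by (simp add: h_simps X.smult_r_distr del: carrier_free_Abelian_group_iff)
      also have "\<dots> = \<zero>\<^bsub>X\<^esub>"
        using right by (simp add: a_minus_def X.a_ac iota_simps X.smult_closed X.r_neg X.r_neg1 X.r_neg2)
      finally show ?thesis by (simp add: ideal_smult.zero)
    next
      case (balanced s n y)
      \<comment> \<open>The balancing relation is sent to \<iota> n (\<iota> (\<pi> s) - s) y, and
        \<pi> annihilates the coefficient because \<pi> \<iota> = id. The difference is written with
        a factor -1 so that \<open>smult_minus_one\<close> applies.\<close>
      let ?a = "\<iota> n \<otimes>\<^bsub>S\<^esub> (\<iota> (\<pi> s) \<oplus>\<^bsub>S\<^esub> (\<ominus>\<^bsub>S\<^esub> \<one>\<^bsub>S\<^esub>) \<otimes>\<^bsub>S\<^esub> s)"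
      have "h c = (\<iota> n \<otimes>\<^bsub>S\<^esub> \<iota> (\<pi> s)) \<odot>\<^bsub>X\<^esub> y \<ominus>\<^bsub>X\<^esub> \<iota> n \<odot>\<^bsub>X\<^esub> (s \<odot>\<^bsub>X\<^esub> y)"
        using balanced by (simp add: h_simps del: carrier_free_Abelian_group_iff)
      also have "\<dots> = ?a \<odot>\<^bsub>X\<^esub> y"
        using balanced
        by (simp add: X.smult_assoc X.smult_l_distr X.smult_r_distr X.smult_minus_one X.smult_r_minus
            iota_simps pi_simps X.smult_closed a_minus_def)
      also have "\<pi> (\<ominus>\<^bsub>S\<^esub> \<one>\<^bsub>S\<^esub>) = \<ominus>\<^bsub>R\<^esub> \<one>\<^bsub>R\<^esub>"
      proof (rule R.minus_equality[symmetric])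
        show "\<pi> (\<ominus>\<^bsub>S\<^esub> \<one>\<^bsub>S\<^esub>) \<oplus>\<^bsub>R\<^esub> \<one>\<^bsub>R\<^esub> = \<zero>\<^bsub>R\<^esub>"
          using pi_simps(2)[of "\<ominus>\<^bsub>S\<^esub> \<one>\<^bsub>S\<^esub>" "\<one>\<^bsub>S\<^esub>"] by (simp add: pi_simps S.l_neg)
      qed (simp_all add: pi_simps)
      then have "?a \<in> J"
        using balanced by (simp add: J_iff iota_simps pi_simps R.l_minus R.r_neg)
      ultimately show ?thesis
        using balanced by (simp add: ideal_smult.smult)
    qed
  qed
  have "h c \<in> ideal_smult J X" if "c \<in> generate (pairs X) (tensor_gens X)" for c
    using that
  proof (induction rule: generate.induct)
    case one
    then show ?case using h.hom_one by (simp add: ideal_smult.zero)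
  next
    case (incl c)
    then show ?case by (rule gens)
  next
    case (inv c)
    then have "c \<in> carrier (pairs X)" by (rule subsetD[OF tensor_gens_subset[OF X]])
    then show ?case
      using ideal_smult_J_uminus[OF X gens[OF inv]] h_minus[of c] by simp
  next
    case (eng c c')
    then have "c \<in> carrier (pairs X)" "c' \<in> carrier (pairs X)"
      using group.generate_in_carrier[OF group_free_Abelian_group tensor_gens_subset[OF X]] by blast+
    then show ?case
      using eng ideal_smult.add[of "h c" J X "h c'"] h_add[of c c'] by simp
  qed
  from this[OF rel[unfolded rel_eq]] show "x \<in> ideal_smult J X"
    using x h_diff[of "frag_of (\<one>\<^bsub>R\<^esub>, x)" "frag_of (\<one>\<^bsub>R\<^esub>, \<zero>\<^bsub>X\<^esub>)"]
    by (simp add: h_of iota_simps X.smult_one X.minus_zero_right)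
qed

subsection \<open>Functoriality and projectivity\<close>

abbreviation "base_map Y f \<equiv> tensor_map S N Y (\<lambda>n. n) f"

lemma base_map_unit:
  assumes X: "left_module S X" and Y: "left_module S Y" and f: "f \<in> left_module_hom S X Y"
  shows "base_map Y f (unit X x) = unit Y (f x)"
  unfolding unit_def by (subst tensor_map_coset[OF X Y f]) simp_all

lemma base_map_hom:
  assumes X: "left_module S X" and Y: "left_module S Y" and f: "f \<in> left_module_hom S X Y"
  shows "base_map Y f \<in> left_module_hom R (base_change S R \<pi> X) (base_change S R \<pi> Y)"
proof -
  interpret X: left_module S X by fact
  have "base_map Y f (unit X x \<oplus>\<^bsub>base_change S R \<pi> X\<^esub> unit X y) =
      unit Y (f x) \<oplus>\<^bsub>base_change S R \<pi> Y\<^esub> unit Y (f y)" if "x \<in> carrier X" "y \<in> carrier X" for x y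
    using that
    by (simp add: base_map_unit[OF assms] left_module_hom_add[OF f] left_module_hom_closed[OF f]
        flip: unit_add[OF X] unit_add[OF Y])
  moreover have "base_map Y f (r \<odot>\<^bsub>base_change S R \<pi> X\<^esub> unit X x) =
      r \<odot>\<^bsub>base_change S R \<pi> Y\<^esub> unit Y (f x)" if "r \<in> carrier R" "x \<in> carrier X" for r x
    using that
    by (simp add: base_map_unit[OF assms] left_module_hom_smult[OF f] left_module_hom_closed[OF f]
        smult_unit[OF X] smult_unit[OF Y] iota_simps)
  ultimately show ?thesis
    by (intro left_module_homI)
      (auto simp: carrier_base_change[OF X] base_map_unit[OF assms] unit_closed[OF Y] left_module_hom_closed[OF f])
qed

definition restrict_scalars :: "('r, 'm) module \<Rightarrow> ('s, 'm) module"
  where "restrict_scalars M = \<lparr>carrier = carrier M, mult = undefined, one = undefined,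
    zero = zero M, add = add M, smult = (\<lambda>s. smult M (\<pi> s))\<rparr>"

lemma restrict_scalars_simps [simp]:
  "carrier (restrict_scalars M) = carrier M" "zero (restrict_scalars M) = zero M"
  "add (restrict_scalars M) = add M" "smult (restrict_scalars M) s = smult M (\<pi> s)"
  by (simp_all add: restrict_scalars_def)

lemma left_module_restrict_scalars:
  assumes "left_module R M"
  shows "left_module S (restrict_scalars M)"
proof -
  interpret M: left_module R M by fact
  show ?thesis
    by (rule left_moduleI[OF S.ring_axioms])
      (auto simp: pi_simps M.smult_closed M.smult_l_distr M.smult_r_distr M.smult_assoc M.smult_one
        M.smult_l_null M.a_ac)
qed

lemma left_module_hom_restrict_scalars:
  "h \<in> left_module_hom R M M' \<Longrightarrow> h \<in> left_module_hom S (restrict_scalars M) (restrict_scalars M')"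
  by (auto simp: left_module_hom_def pi_simps)

lemma unit_hom: "left_module S X \<Longrightarrow> unit X \<in> left_module_hom S X (restrict_scalars (base_change S R \<pi> X))"
  by (rule left_module_homI) (simp_all add: unit_closed unit_add unit_smult)

lemma unit_eq_iff:
  assumes X: "left_module S X" and x: "x \<in> carrier X" and y: "y \<in> carrier X"
  shows "unit X x = unit X y \<longleftrightarrow> x \<ominus>\<^bsub>X\<^esub> y \<in> ideal_smult J X"
proof -
  interpret X: left_module S X by fact
  interpret B: left_module R "base_change S R \<pi> X" by (rule left_module_base_change[OF X])
  have "unit X x = unit X y \<longleftrightarrow> unit X x \<ominus>\<^bsub>base_change S R \<pi> X\<^esub> unit X y = \<zero>\<^bsub>base_change S R \<pi> X\<^esub>"
    using B.minus_eq_zeroD[of "unit X x" "unit X y"] B.minus_self x y by (auto simp: unit_closed[OF X])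
  then show ?thesis
    using unit_eq_zero_iff[OF X, of "x \<ominus>\<^bsub>X\<^esub> y"] unit_diff[OF X x y] x y by simp
qed

lemma hom_vanishes_on_ideal_smult:
  assumes X: "left_module S X" and M: "left_module R M"
    and h: "h \<in> left_module_hom S X (restrict_scalars M)" and "x \<in> ideal_smult J X"
  shows "h x = \<zero>\<^bsub>M\<^esub>"
proof -
  interpret M: left_module R M by fact
  have hc: "h x \<in> carrier M" if "x \<in> carrier X" for x
    using left_module_hom_closed[OF h that] by simp
  show ?thesis
    using assms(4)
  proof induction
    case zero
    then show ?case
      using left_module_hom_zero[OF h X left_module_restrict_scalars[OF M]] by simp
  next
    case (smult a x)
    then show ?case
      using left_module_hom_smult[OF h, of a x] by (simp add: J_iff M.smult_l_null hc)
  next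
    case (add x y)
    then show ?case
      using left_module_hom_add[OF h, of x y] by (simp add: ideal_smult_J_carrier[OF X])
  qed
qed

text \<open>The ideal J acts as zero on R-modules, so h kills J X and is constant on the fibres of
  \<open>unit\<close>. Evaluating it at an arbitrary preimage thus defines h'.\<close>

lemma unit_universal:
  assumes X: "left_module S X" and M: "left_module R M"
    and h: "h \<in> left_module_hom S X (restrict_scalars M)"
  obtains h' where "h' \<in> left_module_hom R (base_change S R \<pi> X) M" "\<forall>x\<in>carrier X. h' (unit X x) = h x"
proof -
  interpret X: left_module S X by fact
  interpret M: left_module R M by fact
  have hc: "h x \<in> carrier M" if "x \<in> carrier X" for x
    using left_module_hom_closed[OF h that] by simp
  have h_add: "h (x \<oplus>\<^bsub>X\<^esub> y) = h x \<oplus>\<^bsub>M\<^esub> h y" if "x \<in> carrier X" "y \<in> carrier X" for x y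
    using left_module_hom_add[OF h that] by simp
  have h_smult: "h (s \<odot>\<^bsub>X\<^esub> x) = \<pi> s \<odot>\<^bsub>M\<^esub> h x" if "s \<in> carrier S" "x \<in> carrier X" for s x
    using left_module_hom_smult[OF h that] by simp
  have h_eq: "h x = h y" if xy: "x \<in> carrier X" "y \<in> carrier X" "unit X x = unit X y" for x y
  proof -
    have "x = (x \<ominus>\<^bsub>X\<^esub> y) \<oplus>\<^bsub>X\<^esub> y"
      using xy by (simp add: a_minus_def X.a_assoc X.l_neg)
    moreover have "h (x \<ominus>\<^bsub>X\<^esub> y) = \<zero>\<^bsub>M\<^esub>"
      using xy by (intro hom_vanishes_on_ideal_smult[OF X M h]) (simp flip: unit_eq_iff[OF X])
    ultimately show ?thesis
      using xy h_add[of "x \<ominus>\<^bsub>X\<^esub> y" y] hc[of y] by simp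
  qed
  let ?s = "inv_into (carrier X) (unit X)"
  have h': "h (?s (unit X x)) = h x" if x: "x \<in> carrier X" for x
  proof (rule h_eq)
    have "unit X x \<in> unit X ` carrier X" using x by (rule imageI)
    then show "?s (unit X x) \<in> carrier X" "unit X (?s (unit X x)) = unit X x"
      by (simp_all add: inv_into_into f_inv_into_f)
  qed (rule x)
  show thesis
  proof
    show "(\<lambda>C. h (?s C)) \<in> left_module_hom R (base_change S R \<pi> X) M"
      by (rule left_module_homI)
        (auto simp: carrier_base_change[OF X] h' hc h_add h_smult iota_simps pi_simps X.smult_closed smult_unit[OF X]
          simp flip: unit_add[OF X])
    show "\<forall>x\<in>carrier X. h (?s (unit X x)) = h x"
      by (simp add: h')
  qed
qed

text \<open>Adjunction: a lifting problem over R becomes one for P over S by restricting scalars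
  along \<pi>, and its solution factors through \<open>unit\<close>.\<close>

lemma projective_base_change:
  assumes P: "projective_module S P"
  shows "projective_module R (base_change S R \<pi> P)"
  unfolding projective_module_def
proof (intro conjI allI impI, goal_cases)
  case 1
  show ?case by (rule left_module_base_change[OF projective_imp_left_module[OF P]])
next
  case (2 M M' g f)
  let ?B = "base_change S R \<pi> P"
  have P': "left_module S P" by (rule projective_imp_left_module[OF P])
  from 2 have M: "left_module R M" and M': "left_module R M'" and g: "g \<in> left_module_hom R M M'"
    "g ` carrier M = carrier M'" and f: "f \<in> left_module_hom R ?B M'"
    by simp_all
  have surj: "g ` carrier (restrict_scalars M) = carrier (restrict_scalars M')"
    using g(2) by simp
  obtain h where h: "h \<in> left_module_hom S P (restrict_scalars M)" "\<forall>x\<in>carrier P. g (h x) = f (unit P x)"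
    by (rule projective_lift[OF P left_module_restrict_scalars[OF M] left_module_restrict_scalars[OF M']
          left_module_hom_restrict_scalars[OF g(1)] surj
          left_module_hom_compose[OF unit_hom[OF P'] left_module_hom_restrict_scalars[OF f]]])
  obtain h' where h': "h' \<in> left_module_hom R ?B M" "\<forall>x\<in>carrier P. h' (unit P x) = h x"
    by (rule unit_universal[OF P' M h(1)])
  show ?case
    using h'(2) h(2) by (intro bexI[OF _ h'(1)]) (simp add: carrier_base_change[OF P'])
qed

subsection \<open>Base change of resolutions\<close>

text \<open>The premise \<open>dx\<close> says that 1 \<otimes> x is a cycle. Triviality of Tor
  leaves the subgroup of boundaries as the only coset of cycles, so the coset of this cycle consists
  of boundaries.\<close>

lemma Tor_trivial_imp_exact:
  assumes X: "left_module S X" and res: "projective_resolution S P d e X"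
    and chosen: "chosen_resolution S X = (P, d, e)"
    and Tor: "trivial_group (Tor S N X (Suc j))"
    and x: "x \<in> carrier (P (Suc j))" and dx: "unit (P j) (d j x) = \<zero>\<^bsub>base_change S R \<pi> (P j)\<^esub>"
  obtains y where "y \<in> carrier (P (Suc (Suc j)))" "unit (P (Suc j)) x = unit (P (Suc j)) (d (Suc j) y)"
proof -
  note PD = projective_resolutionD[OF res]
  let ?T = "\<lambda>j. tensor_group S N (P j)"
  let ?I = "base_map (P (Suc j)) (d (Suc j)) ` carrier (?T (Suc (Suc j)))"
  let ?Z = "kernel (?T (Suc j)) (?T j) (base_map (P j) (d j))"
  interpret T: comm_group "?T (Suc j)" by (rule comm_group_tensor_group[OF PD(2)])
  have I: "?I = (\<lambda>y. unit (P (Suc j)) (d (Suc j) y)) ` carrier (P (Suc (Suc j)))"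
    by (simp add: carrier_tensor_group[OF PD(2)] image_image base_map_unit[OF PD(2) PD(2) PD(3)])
  have "carrier ((?T (Suc j))\<lparr>carrier := ?Z\<rparr> Mod ?I) = {?I}"
    using Tor by (simp add: trivial_group_def Tor_def chosen)
  then have coset: "?I #>\<^bsub>(?T (Suc j))\<lparr>carrier := ?Z\<rparr>\<^esub> z = ?I" if "z \<in> ?Z" for z
    using that by (auto simp: carrier_FactGroup)
  have "unit (P (Suc j)) x \<in> ?Z"
    using x dx by (simp add: kernel_def carrier_tensor_group[OF PD(2)] base_map_unit[OF PD(2) PD(2) PD(3)] base_change_simps)
  note coset[OF this]
  \<comment> \<open>With the neutral element among the boundaries, the cycle belongs to its own
    coset.\<close>
  moreover have "\<one>\<^bsub>?T (Suc j)\<^esub> \<in> ?I"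
  proof -
    have "\<one>\<^bsub>?T (Suc j)\<^esub> = unit (P (Suc j)) (d (Suc j) \<zero>\<^bsub>P (Suc (Suc j))\<^esub>)"
      using left_module_hom_zero[OF PD(3) PD(2) PD(2)] unit_zero[OF PD(2)] by (simp add: base_change_simps)
    moreover have "\<zero>\<^bsub>P (Suc (Suc j))\<^esub> \<in> carrier (P (Suc (Suc j)))"
      using left_submodule_carrier[OF PD(2)] by (simp add: left_submodule_def)
    ultimately show ?thesis unfolding I by (rule image_eqI)
  qed
  then have "\<one>\<^bsub>?T (Suc j)\<^esub> \<otimes>\<^bsub>?T (Suc j)\<^esub> unit (P (Suc j)) x \<in> ?I #>\<^bsub>(?T (Suc j))\<lparr>carrier := ?Z\<rparr>\<^esub> unit (P (Suc j)) x"
    by (auto simp: r_coset_def)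
  moreover have "unit (P (Suc j)) x \<in> carrier (?T (Suc j))"
    using x by (simp add: carrier_tensor_group[OF PD(2)])
  ultimately have "unit (P (Suc j)) x \<in> ?I"
    by simp
  then show thesis
    unfolding I using that by auto
qed

text \<open>The module factor of each product lifts along f while its coefficient in J is kept. This
  supplies right exactness at the augmentation.\<close>

lemma ideal_smult_image:
  assumes M: "left_module S M" and X: "left_module S X" and f: "f \<in> left_module_hom S M X"
    and surj: "f ` carrier M = carrier X" and "x \<in> ideal_smult J X"
  shows "\<exists>y\<in>ideal_smult J M. f y = x"
  using assms(5)
proof induction
  case zero
  show ?case
    using left_module_hom_zero[OF f M X] ideal_smult.zero[of M J] by blast
next
  case (smult a x)
  then obtain m where "m \<in> carrier M" "x = f m" using surj by auto
  then show ?case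
    using smult(1) by (intro bexI[OF _ ideal_smult.smult[of a J m M]]) (simp_all add: left_module_hom_smult[OF f] J_iff)
next
  case (add x y)
  then obtain m n where "m \<in> ideal_smult J M" "n \<in> ideal_smult J M" "f m = x" "f n = y" by blast
  then show ?case
    by (intro bexI[OF _ ideal_smult.add[of m J M n]])
      (simp_all add: left_module_hom_add[OF f] ideal_smult_J_carrier[OF M])
qed

lemma projective_resolution_base_change:
  assumes X: "left_module S X" and res: "projective_resolution S P d e X"
    and chosen: "chosen_resolution S X = (P, d, e)"
    and Tor: "\<And>i. i > 0 \<Longrightarrow> trivial_group (Tor S N X i)"
  shows "projective_resolution R (\<lambda>i. base_change S R \<pi> (P i)) (\<lambda>i. base_map (P i) (d i)) (base_map X e)
    (base_change S R \<pi> X)"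
proof (rule projective_resolutionI)
  note PD = projective_resolutionD[OF res]
  let ?B = "base_change S R \<pi>"
  note d_unit = base_map_unit[OF PD(2) PD(2) PD(3)] and e_unit = base_map_unit[OF PD(2) X PD(4)]
  show "projective_module R (?B (P i))" for i
    by (rule projective_base_change[OF PD(1)])
  show "base_map (P i) (d i) \<in> left_module_hom R (?B (P (Suc i))) (?B (P i))" for i
    by (rule base_map_hom[OF PD(2) PD(2) PD(3)])
  show "base_map X e \<in> left_module_hom R (?B (P 0)) (?B X)"
    by (rule base_map_hom[OF PD(2) X PD(4)])
  show "base_map X e ` carrier (?B (P 0)) = carrier (?B X)"
    by (simp add: carrier_base_change[OF PD(2)] carrier_base_change[OF X] image_image e_unit flip: PD(5))
  show "a_kernel (?B (P 0)) (?B X) (base_map X e) = base_map (P 0) (d 0) ` carrier (?B (P (Suc 0)))"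
  proof (intro equalityI subsetI)
    fix C assume "C \<in> a_kernel (?B (P 0)) (?B X) (base_map X e)"
    then obtain x where x: "x \<in> carrier (P 0)" "C = unit (P 0) x" "unit X (e x) = \<zero>\<^bsub>?B X\<^esub>"
      by (auto simp: a_kernel_def' carrier_base_change[OF PD(2)] e_unit)
    interpret P0: left_module S "P 0" by (rule PD(2))
    interpret X: left_module S X by (rule X)
    \<comment> \<open>In degree 0 exactness does not come from Tor: x is corrected by an element y
      of J (P 0) with e y = e x. The correction is invisible in R \<otimes> P 0 and makes x - y a
      boundary.\<close>
    have "e x \<in> ideal_smult J X"
      using x left_module_hom_closed[OF PD(4)] by (simp flip: unit_eq_zero_iff[OF X])
    from ideal_smult_image[OF PD(2) X PD(4,5) this] obtain y where y: "y \<in> ideal_smult J (P 0)" "e y = e x"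
      by blast
    note yc = ideal_smult_J_carrier[OF PD(2) y(1)]
    have "e (x \<ominus>\<^bsub>P 0\<^esub> y) = \<zero>\<^bsub>X\<^esub>"
      using left_module_hom_diff[OF PD(4) PD(2) X x(1) yc] y(2) X.minus_self left_module_hom_closed[OF PD(4) x(1)]
      by simp
    then have "x \<ominus>\<^bsub>P 0\<^esub> y \<in> d 0 ` carrier (P (Suc 0))"
      using x yc by (intro PD(7)) simp_all
    then obtain z where z: "z \<in> carrier (P (Suc 0))" "x \<ominus>\<^bsub>P 0\<^esub> y = d 0 z"
      by auto
    have "x \<ominus>\<^bsub>P 0\<^esub> d 0 z = y"
      using x yc by (simp flip: z(2) add: a_minus_def P0.minus_add P0.r_neg1 P0.r_neg2 P0.r_neg flip: P0.a_assoc)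
    then have "C = unit (P 0) (d 0 z)"
      using x y(1) left_module_hom_closed[OF PD(3) z(1)] by (simp add: unit_eq_iff[OF PD(2)])
    then show "C \<in> base_map (P 0) (d 0) ` carrier (?B (P (Suc 0)))"
      using z by (simp add: carrier_base_change[OF PD(2)] image_image d_unit)
  next
    fix C assume "C \<in> base_map (P 0) (d 0) ` carrier (?B (P (Suc 0)))"
    then show "C \<in> a_kernel (?B (P 0)) (?B X) (base_map X e)"
      by (auto simp: a_kernel_def' carrier_base_change[OF PD(2)] e_unit d_unit PD(6) unit_zero[OF X]
          left_module_hom_closed[OF PD(3)])
  qed
  show "a_kernel (?B (P (Suc i))) (?B (P i)) (base_map (P i) (d i)) =
      base_map (P (Suc i)) (d (Suc i)) ` carrier (?B (P (Suc (Suc i))))" for i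
  proof (intro equalityI subsetI)
    fix C assume "C \<in> a_kernel (?B (P (Suc i))) (?B (P i)) (base_map (P i) (d i))"
    then obtain x where x: "x \<in> carrier (P (Suc i))" "C = unit (P (Suc i)) x"
      "unit (P i) (d i x) = \<zero>\<^bsub>?B (P i)\<^esub>"
      by (auto simp: a_kernel_def' carrier_base_change[OF PD(2)] d_unit)
    obtain y where "y \<in> carrier (P (Suc (Suc i)))" "unit (P (Suc i)) x = unit (P (Suc i)) (d (Suc i) y)"
      by (rule Tor_trivial_imp_exact[OF X res chosen Tor x(1,3)]) simp
    then show "C \<in> base_map (P (Suc i)) (d (Suc i)) ` carrier (?B (P (Suc (Suc i))))"
      using x by (simp add: carrier_base_change[OF PD(2)] image_image d_unit)
  next
    fix C assume "C \<in> base_map (P (Suc i)) (d (Suc i)) ` carrier (?B (P (Suc (Suc i))))"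
    then show "C \<in> a_kernel (?B (P (Suc i))) (?B (P i)) (base_map (P i) (d i))"
      by (auto simp: a_kernel_def' carrier_base_change[OF PD(2)] d_unit PD(8) unit_zero[OF PD(2)]
          left_module_hom_closed[OF PD(3)])
  qed
qed

lemma splits_at_base_change:
  assumes res: "projective_resolution S P d e X" and "splits_at S P d n"
  shows "splits_at R (\<lambda>i. base_change S R \<pi> (P i)) (\<lambda>i. base_map (P i) (d i)) n"
proof -
  note PD = projective_resolutionD[OF res]
  obtain \<sigma> where \<sigma>: "\<sigma> \<in> left_module_hom S (P n) (P n)"
      "\<And>x. x \<in> carrier (P (Suc n)) \<Longrightarrow> \<sigma> (d n x) = \<zero>\<^bsub>P n\<^esub>"
      "\<And>x. x \<in> carrier (P n) \<Longrightarrow> x \<ominus>\<^bsub>P n\<^esub> \<sigma> x \<in> d n ` carrier (P (Suc n))"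
    using assms(2) unfolding splits_at_def by blast
  note d_unit = base_map_unit[OF PD(2) PD(2) PD(3)] and \<sigma>_unit = base_map_unit[OF PD(2) PD(2) \<sigma>(1)]
  show ?thesis
    unfolding splits_at_def
  proof (intro bexI[OF _ base_map_hom[OF PD(2) PD(2) \<sigma>(1)]] conjI ballI)
    fix C assume "C \<in> carrier (base_change S R \<pi> (P (Suc n)))"
    then show "base_map (P n) \<sigma> (base_map (P n) (d n) C) = \<zero>\<^bsub>base_change S R \<pi> (P n)\<^esub>"
      by (auto simp: carrier_base_change[OF PD(2)] d_unit \<sigma>_unit \<sigma>(2) unit_zero[OF PD(2)])
  next
    fix C assume "C \<in> carrier (base_change S R \<pi> (P n))"
    then obtain x where x: "x \<in> carrier (P n)" "C = unit (P n) x"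
      by (auto simp: carrier_base_change[OF PD(2)])
    have "C \<ominus>\<^bsub>base_change S R \<pi> (P n)\<^esub> base_map (P n) \<sigma> C = unit (P n) (x \<ominus>\<^bsub>P n\<^esub> \<sigma> x)"
      using x by (simp add: \<sigma>_unit unit_diff[OF PD(2)] left_module_hom_closed[OF \<sigma>(1)])
    also have "\<dots> \<in> base_map (P n) (d n) ` carrier (base_change S R \<pi> (P (Suc n)))"
      using \<sigma>(3)[OF x(1)] by (auto simp: carrier_base_change[OF PD(2)] image_image d_unit)
    finally show "C \<ominus>\<^bsub>base_change S R \<pi> (P n)\<^esub> base_map (P n) \<sigma> C \<in>
      base_map (P n) (d n) ` carrier (base_change S R \<pi> (P (Suc n)))" .
  qed
qed

subsection \<open>Lifting splittings along a nilpotent ideal\<close>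

text \<open>The order of the factors matches \<open>J_power_Suc\<close>, where the new factor J
  stands on the right.\<close>

lemma ideal_smult_prod:
  assumes X: "left_module S X" and I: "I \<subseteq> carrier S" and a: "a \<in> I" and "x \<in> ideal_smult J X"
  shows "a \<odot>\<^bsub>X\<^esub> x \<in> ideal_smult (ideal_prod S I J) X"
proof -
  interpret X: left_module S X by fact
  have a': "a \<in> carrier S" using a I by blast
  show ?thesis
    using assms(4)
  proof induction
    case zero
    then show ?case using X.smult_r_null[OF a'] ideal_smult.zero by simp
  next
    case (smult b x)
    then show ?case
      using ideal_smult.smult[OF ideal_prod.prod[OF a smult(1), where R = S] smult(2)] X.smult_assoc[OF a', of b x]
      by (simp add: J_iff)
  next
    case (add x y)
    then show ?case
      by (simp add: X.smult_r_distr[OF a'] ideal_smult_J_carrier[OF X] ideal_smult.add)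
  qed
qed

lemma ideal_prod_subset:
  assumes "I \<subseteq> carrier S" "I' \<subseteq> carrier S"
  shows "ideal_prod S I I' \<subseteq> carrier S"
proof
  fix a assume "a \<in> ideal_prod S I I'"
  then show "a \<in> carrier S"
    by induction (use assms in auto)
qed

lemma J_power_Suc: "J [^]\<^bsub>ideals_set S\<^esub> Suc k = ideal_prod S (J [^]\<^bsub>ideals_set S\<^esub> k) J"
  by (simp add: ideals_set_def)

lemma J_power_0: "J [^]\<^bsub>ideals_set S\<^esub> (0::nat) = carrier S"
  by (simp add: ideals_set_def)

lemma J_power_subset: "J [^]\<^bsub>ideals_set S\<^esub> (k::nat) \<subseteq> carrier S"
proof (induction k)
  case 0
  then show ?case by (simp only: J_power_0)
next
  case (Suc k)
  then show ?case
    unfolding J_power_Suc by (rule ideal_prod_subset) (auto simp: J_iff)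
qed

text \<open>A lift \<open>\<tau>\<close> of the projection on the level of \<open>R\<close> kills the image of \<open>d n\<close> only modulo \<open>J\<close>, but
  exactness after base change places the error in \<open>d n (J P)\<close>, so that a power of \<open>\<tau>\<close> is a projection.\<close>

lemma splits_at_of_base_change:
  fixes P :: "nat \<Rightarrow> ('s, 'p) module" and t :: nat
  assumes res: "projective_resolution S P d e X"
    and res': "projective_resolution R (\<lambda>i. base_change S R \<pi> (P i)) (\<lambda>i. base_map (P i) (d i)) e' X'"
    and nilpotent: "J [^]\<^bsub>ideals_set S\<^esub> t = {\<zero>\<^bsub>S\<^esub>}"
    and "splits_at R (\<lambda>i. base_change S R \<pi> (P i)) (\<lambda>i. base_map (P i) (d i)) n"
  shows "splits_at S P d n"
proof -
  note PD = projective_resolutionD[OF res] and PD' = projective_resolutionD[OF res']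
  note d_unit = base_map_unit[OF PD(2) PD(2) PD(3)]
  let ?B = "\<lambda>i. base_change S R \<pi> (P i)"
  interpret Pn: left_module S "P n" by (rule PD(2))
  interpret PSn: left_module S "P (Suc n)" by (rule PD(2))
  interpret Bn: left_module R "?B n" by (rule PD'(2))
  obtain \<sigma> where \<sigma>: "\<sigma> \<in> left_module_hom R (?B n) (?B n)"
      "\<And>C. C \<in> carrier (?B (Suc n)) \<Longrightarrow> \<sigma> (base_map (P n) (d n) C) = \<zero>\<^bsub>?B n\<^esub>"
      "\<And>C. C \<in> carrier (?B n) \<Longrightarrow> C \<ominus>\<^bsub>?B n\<^esub> \<sigma> C \<in> base_map (P n) (d n) ` carrier (?B (Suc n))"
    using assms(4) unfolding splits_at_def by blast
  \<comment> \<open>The complement 1 - \<sigma>, composed with \<open>unit\<close>. Its values lie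
    in the image of R \<otimes> d n, hence it can be lifted to a map h into P (n + 1) rather than
    merely into P n.\<close>
  let ?f = "\<lambda>x. unit (P n) x \<ominus>\<^bsub>?B n\<^esub> \<sigma> (unit (P n) x)"
  have f: "?f \<in> left_module_hom S (P n) (restrict_scalars (?B n))"
    by (rule left_module_hom_compose[OF unit_hom[OF PD(2)]
          left_module_hom_restrict_scalars[OF left_module_hom_minus[OF left_module_hom_id \<sigma>(1) PD'(2)]]])
  have sub: "?f ` carrier (P n) \<subseteq> (\<lambda>x. unit (P n) (d n x)) ` carrier (P (Suc n))"
  proof (rule image_subsetI)
    fix x assume "x \<in> carrier (P n)"
    then show "?f x \<in> (\<lambda>x. unit (P n) (d n x)) ` carrier (P (Suc n))"
      using \<sigma>(3)[OF unit_closed[OF PD(2)]] by (simp add: carrier_base_change[OF PD(2)] image_image d_unit)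
  qed
  obtain h where h: "h \<in> left_module_hom S (P n) (P (Suc n))"
    "\<forall>x\<in>carrier (P n). unit (P n) (d n (h x)) = ?f x"
    by (rule projective_lift_into_image[OF PD(1) PD(2) left_module_restrict_scalars[OF PD'(2)]
          left_module_hom_compose[OF PD(3) unit_hom[OF PD(2)]] f sub])
  note closed = left_module_hom_closed[OF PD(3)] left_module_hom_closed[OF h(1)]
  \<comment> \<open>By the choice of h, \<tau> induces \<sigma> on R \<otimes> P n, while x - \<tau>
    x = d n (h x) is a boundary by construction.\<close>
  define \<tau> where "\<tau> x = x \<ominus>\<^bsub>P n\<^esub> d n (h x)" for x
  have \<tau>: "\<tau> \<in> left_module_hom S (P n) (P n)"
    unfolding \<tau>_def
    by (rule left_module_hom_minus[OF left_module_hom_id left_module_hom_compose[OF h(1) PD(3)] PD(2)])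
  \<comment> \<open>The element ?p satisfies d n ?p = \<tau> (d n q), which is zero in R \<otimes> P
    n because \<sigma> kills boundaries. Exactness over R gives y such that ?p - d (n + 1) y lies in
    J (P (n + 1)); this difference is the witness, since d n sends it to the same element as
    ?p.\<close>
  have \<tau>_d: "\<exists>p\<in>ideal_smult J (P (Suc n)). \<tau> (d n q) = d n p" if q: "q \<in> carrier (P (Suc n))" for q
  proof -
    let ?p = "q \<ominus>\<^bsub>P (Suc n)\<^esub> h (d n q)"
    have p: "?p \<in> carrier (P (Suc n))" using q by (simp add: closed)
    have dp: "d n ?p = \<tau> (d n q)"
      unfolding \<tau>_def using q by (intro left_module_hom_diff[OF PD(3) PD(2) PD(2)]) (simp_all add: closed)
    have "\<sigma> (unit (P n) (d n q)) = \<zero>\<^bsub>?B n\<^esub>"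
      using \<sigma>(2)[OF unit_closed[OF PD(2) q]] by (simp add: d_unit)
    then have "unit (P n) (\<tau> (d n q)) = \<zero>\<^bsub>?B n\<^esub>"
      using q h(2) unit_closed[OF PD(2) closed(1)[OF q]]
      by (simp add: \<tau>_def unit_diff[OF PD(2)] closed Bn.minus_zero_right Bn.minus_self)
    then have "unit (P (Suc n)) ?p \<in> base_map (P (Suc n)) (d (Suc n)) ` carrier (?B (Suc (Suc n)))"
      using p by (intro PD'(9)) (simp_all add: unit_closed[OF PD(2)] d_unit dp)
    then obtain y where y: "y \<in> carrier (P (Suc (Suc n)))" "unit (P (Suc n)) ?p = unit (P (Suc n)) (d (Suc n) y)"
      by (auto simp: carrier_base_change[OF PD(2)] d_unit)
    have "d n (?p \<ominus>\<^bsub>P (Suc n)\<^esub> d (Suc n) y) = d n ?p \<ominus>\<^bsub>P n\<^esub> d n (d (Suc n) y)"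
      using p y by (intro left_module_hom_diff[OF PD(3) PD(2) PD(2)]) (simp_all add: closed)
    also have "\<dots> = \<tau> (d n q)"
      using y closed(1)[OF p] by (simp add: PD(8) dp Pn.minus_zero_right)
    finally show ?thesis
      using y p by (intro bexI[of _ "?p \<ominus>\<^bsub>P (Suc n)\<^esub> d (Suc n) y"])
        (simp_all add: closed flip: unit_eq_iff[OF PD(2)])
  qed
  \<comment> \<open>Linearity pulls a coefficient from I out of \<tau> and d n, and
    \<open>\<tau>_d\<close> contributes one further factor from J on its right.\<close>
  have step: "\<exists>p'\<in>ideal_smult (ideal_prod S I J) (P (Suc n)). \<tau> (d n p) = d n p'"
    if "p \<in> ideal_smult I (P (Suc n))" and I: "I \<subseteq> carrier S" for p I
    using that(1)
  proof induction
    case zero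
    show ?case
      using left_module_hom_zero[OF PD(3) PD(2) PD(2)] left_module_hom_zero[OF \<tau> PD(2) PD(2)]
      by (intro bexI[of _ "\<zero>\<^bsub>P (Suc n)\<^esub>"] ideal_smult.zero) simp
  next
    case (smult a x)
    obtain p where p: "p \<in> ideal_smult J (P (Suc n))" "\<tau> (d n x) = d n p"
      using \<tau>_d[OF smult(2)] by blast
    have "a \<in> carrier S" using smult(1) I by blast
    then show ?case
      using smult(2) p(2) ideal_smult_J_carrier[OF PD(2) p(1)]
      by (intro bexI[OF _ ideal_smult_prod[OF PD(2) I smult(1) p(1)]])
        (simp add: left_module_hom_smult[OF PD(3)] left_module_hom_smult[OF \<tau>] closed)
  next
    case (add x y)
    have carr: "z \<in> carrier (P (Suc n))" if "z \<in> ideal_smult K (P (Suc n))" "K \<subseteq> carrier S" for z K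
      using that by induction (auto simp: PSn.smult_closed subset_iff)
    from add obtain p p' where pp: "p \<in> ideal_smult (ideal_prod S I J) (P (Suc n))" "\<tau> (d n x) = d n p"
      "p' \<in> ideal_smult (ideal_prod S I J) (P (Suc n))" "\<tau> (d n y) = d n p'" by blast
    have IJ: "ideal_prod S I J \<subseteq> carrier S"
      using I by (rule ideal_prod_subset) (auto simp: J_iff)
    show ?case
      using pp add carr[OF _ I] carr[OF _ IJ]
      by (intro bexI[OF _ ideal_smult.add[OF pp(1,3)]])
        (simp add: left_module_hom_add[OF PD(3)] left_module_hom_add[OF \<tau>] closed)
  qed
  have power: "\<exists>p\<in>ideal_smult (J [^]\<^bsub>ideals_set S\<^esub> k) (P (Suc n)). (\<tau> ^^ k) (d n q) = d n p"
    if q: "q \<in> carrier (P (Suc n))" for k :: nat and q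
  proof (induction k)
    case 0
    \<comment> \<open>The zeroth power of J is all of S, so the base case only needs q written as
      the multiple 1 q.\<close>
    have "\<one>\<^bsub>S\<^esub> \<odot>\<^bsub>P (Suc n)\<^esub> q \<in> ideal_smult (J [^]\<^bsub>ideals_set S\<^esub> (0::nat)) (P (Suc n))"
      unfolding J_power_0 using q by (intro ideal_smult.smult) simp_all
    then show ?case using PSn.smult_one[OF q] by (intro bexI[of _ q]) simp_all
  next
    case (Suc k)
    then obtain p where p: "p \<in> ideal_smult (J [^]\<^bsub>ideals_set S\<^esub> k) (P (Suc n))"
      "(\<tau> ^^ k) (d n q) = d n p" by blast
    show ?case
      using step[OF p(1) J_power_subset] p(2) by (simp only: J_power_Suc funpow.simps o_apply)
  qed
  have \<tau>_power: "\<tau> ^^ k \<in> left_module_hom S (P n) (P n)" for k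
  proof (induction k)
    case 0
    then show ?case using left_module_hom_id[of S "P n"] by (simp add: id_def)
  next
    case (Suc k)
    then show ?case using left_module_hom_compose[OF Suc \<tau>] by (simp add: o_def)
  qed
  \<comment> \<open>With y = \<tau>^k x, the difference x - \<tau> y equals (x - y) + d n (h y), a
    sum of two boundaries.\<close>
  have diff: "x \<ominus>\<^bsub>P n\<^esub> (\<tau> ^^ k) x \<in> d n ` carrier (P (Suc n))" if x: "x \<in> carrier (P n)" for x k
  proof (induction k)
    case 0
    have "x \<ominus>\<^bsub>P n\<^esub> x = d n \<zero>\<^bsub>P (Suc n)\<^esub>"
      using x left_module_hom_zero[OF PD(3) PD(2) PD(2)] by (simp add: Pn.minus_self)
    then show ?case by (simp add: image_eqI[of _ _ "\<zero>\<^bsub>P (Suc n)\<^esub>"])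
  next
    case (Suc k)
    let ?y = "(\<tau> ^^ k) x"
    have y: "?y \<in> carrier (P n)" by (rule left_module_hom_closed[OF \<tau>_power x])
    obtain z where z: "z \<in> carrier (P (Suc n))" "x \<ominus>\<^bsub>P n\<^esub> ?y = d n z"
      using Suc by auto
    have "x \<ominus>\<^bsub>P n\<^esub> \<tau> ?y = (x \<ominus>\<^bsub>P n\<^esub> ?y) \<oplus>\<^bsub>P n\<^esub> d n (h ?y)"
      using x y closed by (simp add: \<tau>_def a_minus_def Pn.minus_add Pn.a_assoc)
    also have "\<dots> = d n (z \<oplus>\<^bsub>P (Suc n)\<^esub> h ?y)"
      using y z by (simp add: left_module_hom_add[OF PD(3)] closed)
    finally show ?case
      using y z closed by (auto intro!: imageI)
  qed
  have "(\<tau> ^^ t) (d n q) = \<zero>\<^bsub>P n\<^esub>" if q: "q \<in> carrier (P (Suc n))" for q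
  proof -
    obtain p where p: "p \<in> ideal_smult {\<zero>\<^bsub>S\<^esub>} (P (Suc n))" "(\<tau> ^^ t) (d n q) = d n p"
      using power[OF q, of t] unfolding nilpotent by blast
    from p(1) have "p = \<zero>\<^bsub>P (Suc n)\<^esub>"
      by induction (auto simp: PSn.smult_l_null)
    then show ?thesis
      using p(2) left_module_hom_zero[OF PD(3) PD(2) PD(2)] by simp
  qed
  then show ?thesis
    unfolding splits_at_def using \<tau>_power[of t] diff[of _ t] by blast
qed

end

text \<open>The \<open>SOME\<close> in \<open>chosen_resolution\<close> is meaningful because a
  resolution over \<open>univ\<close> exists.\<close>

lemma projective_resolution_chosen:
  assumes "left_module S X" and "chosen_resolution S X = (P, d, e)"
  shows "projective_resolution S P d e X"
proof -
  obtain P' :: "nat \<Rightarrow> ('a, ('a, 'c) univ) module" and d' e' where "projective_resolution S P' d' e' X"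
    by (rule projective_resolution_exists[OF assms(1)])
  then have "\<exists>r :: (nat \<Rightarrow> ('a, ('a, 'c) univ) module) \<times> (nat \<Rightarrow> ('a, 'c) univ \<Rightarrow> ('a, 'c) univ) \<times> (('a, 'c) univ \<Rightarrow> 'c).
      case r of (P, d, e) \<Rightarrow> projective_resolution S P d e X"
    by (intro exI[of _ "(P', d', e')"]) simp
  from someI_ex[OF this] show ?thesis
    using assms(2) unfolding chosen_resolution_def by simp
qed

theorem theorem3p2:
  fixes S :: "('s, 'k) ring_scheme" and R :: "('r, 'l) ring_scheme"
    and \<iota> :: "'r \<Rightarrow> 's" and \<pi> :: "'s \<Rightarrow> 'r" and X :: "('s, 'x) module"
  assumes "split_by_nilpotent_extension S R \<iota> \<pi>"
    and "left_module S X"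
    and "\<And>i. i > 0 \<Longrightarrow> trivial_group (Tor S (right_module_via R \<pi>) X i)"
  shows "proj_dim S X = proj_dim R (base_change S R \<pi> X)"
proof -
  interpret split_extension S R \<iota> \<pi>
    using assms(1)
    by (simp add: split_by_nilpotent_extension_def split_extension_def split_extension_axioms_def)
  obtain t :: nat where t: "J [^]\<^bsub>ideals_set S\<^esub> t = {\<zero>\<^bsub>S\<^esub>}"
    using assms(1) unfolding split_by_nilpotent_extension_def by blast
  obtain P d e where chosen: "chosen_resolution S X = (P, d, e)"
    by (cases "chosen_resolution S X") auto
  have res: "projective_resolution S P d e X"
    by (rule projective_resolution_chosen[OF assms(2) chosen])
  \<comment> \<open>The base change must be that of the chosen resolution, as Tor is computed from
    it.\<close>
  note res' = projective_resolution_base_change[OF assms(2) res chosen assms(3)]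
  have "splits_at S P d n \<longleftrightarrow>
      splits_at R (\<lambda>i. base_change S R \<pi> (P i)) (\<lambda>i. base_map (P i) (d i)) n" for n
    using splits_at_base_change[OF res] splits_at_of_base_change[OF res res' t] by blast
  \<comment> \<open>Both dimensions are now infima of one and the same set of degrees; if it is
    empty, both are infinite.\<close>
  then show ?thesis
    by (simp add: proj_dim_eq[OF res assms(2)] proj_dim_eq[OF res' left_module_base_change[OF assms(2)]])
qed

end
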